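(* Let $\Gamma$ be a typing context of $CC_\omega$ and $\Xi$ a parametricity context with $\Gamma \rhd \Xi$. Let $M, A, M', M_R, A', A_R$ be terms such that $\Gamma \vdash M : A$, $\Xi \vdash M \sim M' \text{ because } M_R$ and $\Xi \vdash A \sim A' \text{ because } A_R$. Then $\Gamma \vdash M' : A'$ and $\Gamma \vdash M_R : A_R\,M\,M'$.
   Context: $CC_\omega$ is the Calculus of Constructions with a predicative hierarchy of universes $\Box_i$; terms: $A,B,M,N ::= \Box_i \mid x \mid M\,N \mid \lambda x : A.\,M \mid \Pi x : A.\,B$, with its standard typing judgment $\Gamma \vdash M : A$ and conversion $\equiv$ ($\alpha\beta$). For a well-formed typing context $\Gamma$, $\Gamma(x)$ denotes the type assigned to $x$ in $\Gamma$. A parametricity context is a list of triples of variables: $\Xi ::= \varepsilon \mid \Xi, (x, x', x_R)$; $\mathrm{Var}(\varepsilon)=\varepsilon$, $\mathrm{Var}(\Xi,(x,x',x_R)) = \mathrm{Var}(\Xi), x, x', x_R$. $\Xi$ is well-formed ($\Xi \vdash$) if $\mathrm{Var}(\Xi)$ has no duplicates; then $\Xi(x)=(x',x_R)$ means $(x,x',x_R)\in\Xi$. The parametricity judgment $\Xi \vdash M \sim M' \text{ because } M_R$ is inductively defined by: (Sort) $\Xi \vdash \Box_i \sim \Box_i \text{ because } \lambda (A\,B : \Box_i).\, A \to B \to \Box_i$. (Var) if $(x,x',x_R) \in \Xi$ and $\Xi \vdash$, then $\Xi \vdash x \sim x' \text{ because } x_R$. (App) if $\Xi \vdash M \sim M'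 \text{ because } M_R$ and $\Xi \vdash N \sim N' \text{ because } N_R$, then $\Xi \vdash M\,N \sim M'\,N' \text{ because } M_R\,N\,N'\,N_R$. (Lam) if $\Xi \vdash A \sim A' \text{ because } A_R$ and $\Xi, (x,x',x_R) \vdash M \sim M' \text{ because } M_R$, then $\Xi \vdash \lambda x : A.\,M \sim \lambda x' : A'.\,M' \text{ because } \lambda (x:A)(x':A')(x_R : A_R\,x\,x').\,M_R$. (Pi) if $x, x' \notin \mathrm{Var}(\Xi)$, $\Xi \vdash A \sim A' \text{ because } A_R$ and $\Xi, (x,x',x_R) \vdash B \sim B' \text{ because } B_R$, then $\Xi \vdash \Pi x : A.\,B \sim \Pi x' : A'.\,B' \text{ because } \lambda f\,g.\,\Pi (x:A)(x':A')(x_R : A_R\,x\,x').\,B_R\,(f\,x)\,(g\,x')$. Admissibility: $\Gamma \rhd \Xi$ holds when $\Gamma$ is a well-formed typing context, $\Xi$ is a well-formed parametricity context, and for all variables $x,x',x_R$ with $\Xi(x) = (x',x_R)$ and all terms $A', A_R$: if $\Xi \vdash \Gamma(x) \sim A' \text{ because } A_R$ then $\Gamma(x') = A'$ and $\Gamma(x_R) \equiv A_R\,x\,x'$.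
   Formalization: The formal theorem additionally assumes that for every (x,x',x_R) in Ξ with x declared in Γ, Γ(x) is related by Ξ to some A' because some A_R; otherwise Γ ▷ Ξ can hold vacuously and the claim fails (e.g. f : B→□_0, n : B with B not in Ξ). *)

theory Defs
  imports Main
begin

section \<open>Terms\<close>

text \<open>
  Terms are considered up to renaming of bound variables. The representation is locally nameless:
  free variables are names, bound variables are indices, so that alpha-equivalent terms are equal.
  All judgments below are phrased with the named binders \<open>lam x A M\<close> and \<open>prd x A B\<close>,
  which bind the free variable \<open>x\<close> in \<open>M\<close> and in \<open>B\<close> (not in \<open>A\<close>).
  The proper terms, without dangling indices, are singled out by \<open>is_trm\<close>.
\<close>

type_synonym name = nat

datatype trm =
    Sort nat  ("\<box>")
  | Free name
  | Bound nat
  | App trm trm  (infixl "\<bullet>" 80)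
  | Lam trm trm
  | Prd trm trm

primrec close :: "nat \<Rightarrow> name \<Rightarrow> trm \<Rightarrow> trm" where
  "close k x (Sort i) = Sort i"
| "close k x (Free y) = (if x = y then Bound k else Free y)"
| "close k x (Bound i) = Bound i"
| "close k x (App M N) = App (close k x M) (close k x N)"
| "close k x (Lam A M) = Lam (close k x A) (close (Suc k) x M)"
| "close k x (Prd A B) = Prd (close k x A) (close (Suc k) x B)"

definition lam :: "name \<Rightarrow> trm \<Rightarrow> trm \<Rightarrow> trm" where
  "lam x A M = Lam A (close 0 x M)"

definition prd :: "name \<Rightarrow> trm \<Rightarrow> trm \<Rightarrow> trm" where
  "prd x A B = Prd A (close 0 x B)"

inductive is_trm :: "trm \<Rightarrow> bool" where
  "is_trm (\<box> i)"
| "is_trm (Free x)"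
| "is_trm M \<Longrightarrow> is_trm N \<Longrightarrow> is_trm (M \<bullet> N)"
| "is_trm A \<Longrightarrow> is_trm M \<Longrightarrow> is_trm (lam x A M)"
| "is_trm A \<Longrightarrow> is_trm B \<Longrightarrow> is_trm (prd x A B)"

text \<open>Non-dependent product: a proper term \<open>B\<close> does not refer to the index bound by \<open>Prd\<close>.\<close>

definition arrow :: "trm \<Rightarrow> trm \<Rightarrow> trm"  (infixr "\<rightarrow>\<^sub>t" 70) where
  "A \<rightarrow>\<^sub>t B = Prd A B"

primrec fv :: "trm \<Rightarrow> name set" where
  "fv (Sort i) = {}"
| "fv (Free x) = {x}"
| "fv (Bound i) = {}"
| "fv (App M N) = fv M \<union> fv N"
| "fv (Lam A M) = fv A \<union> fv M"
| "fv (Prd A B) = fv A \<union> fv B"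

text \<open>Substitution for a free variable; it is capture-avoiding when \<open>N\<close> is a proper term.\<close>

primrec subst :: "trm \<Rightarrow> name \<Rightarrow> trm \<Rightarrow> trm"  ("_[_ ::= _]" [100, 0, 0] 100) where
  "(Sort i)[x ::= N] = Sort i"
| "(Free y)[x ::= N] = (if x = y then N else Free y)"
| "(Bound i)[x ::= N] = Bound i"
| "(App M P)[x ::= N] = App (M[x ::= N]) (P[x ::= N])"
| "(Lam A M)[x ::= N] = Lam (A[x ::= N]) (M[x ::= N])"
| "(Prd A B)[x ::= N] = Prd (A[x ::= N]) (B[x ::= N])"


section \<open>Conversion and typing\<close>

inductive beta :: "trm \<Rightarrow> trm \<Rightarrow> bool"  (infix "\<rightarrow>\<^sub>\<beta>" 50) where
  beta: "is_trm A \<Longrightarrow> is_trm M \<Longrightarrow> is_trm N \<Longrightarrow> lam x A M \<bullet> N \<rightarrow>\<^sub>\<beta> M[x ::= N]"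
| App1: "M \<rightarrow>\<^sub>\<beta> M' \<Longrightarrow> is_trm N \<Longrightarrow> M \<bullet> N \<rightarrow>\<^sub>\<beta> M' \<bullet> N"
| App2: "is_trm M \<Longrightarrow> N \<rightarrow>\<^sub>\<beta> N' \<Longrightarrow> M \<bullet> N \<rightarrow>\<^sub>\<beta> M \<bullet> N'"
| Lam1: "A \<rightarrow>\<^sub>\<beta> A' \<Longrightarrow> is_trm M \<Longrightarrow> lam x A M \<rightarrow>\<^sub>\<beta> lam x A' M"
| Lam2: "is_trm A \<Longrightarrow> M \<rightarrow>\<^sub>\<beta> M' \<Longrightarrow> lam x A M \<rightarrow>\<^sub>\<beta> lam x A M'"
| Pi1: "A \<rightarrow>\<^sub>\<beta> A' \<Longrightarrow> is_trm B \<Longrightarrow> prd x A B \<rightarrow>\<^sub>\<beta> prd x A' B"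
| Pi2: "is_trm A \<Longrightarrow> B \<rightarrow>\<^sub>\<beta> B' \<Longrightarrow> prd x A B \<rightarrow>\<^sub>\<beta> prd x A B'"

abbreviation conv :: "trm \<Rightarrow> trm \<Rightarrow> bool"  (infix "\<equiv>\<^sub>\<beta>" 50) where
  "A \<equiv>\<^sub>\<beta> B \<equiv> equivclp beta A B"

text \<open>
  The most recent declaration is at the head of the list: \<open>(x, A) # \<Gamma>\<close> is the context usually
  written with \<open>x : A\<close> appended on the right. The type of \<open>x\<close> in \<open>\<Gamma>\<close> is
  \<open>map_of \<Gamma> x\<close>. The system is the pure type system with sorts \<open>\<box> i\<close>, axioms
  \<open>\<box> i : \<box> (i + 1)\<close> and predicative products, without cumulativity. In \<open>T_App\<close>,
  \<open>is_trm B\<close> excludes bodies with dangling indices, for which \<open>prd x A B\<close> does not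
  determine \<open>B\<close> up to renaming of \<open>x\<close>.
\<close>

type_synonym ctx = "(name \<times> trm) list"

inductive wf_ctx :: "ctx \<Rightarrow> bool"
  and typing :: "ctx \<Rightarrow> trm \<Rightarrow> trm \<Rightarrow> bool"  ("_ \<turnstile> _ \<^bold>: _" [50, 50, 50] 50)
  where
  wf_Nil: "wf_ctx []"
| wf_Cons: "wf_ctx \<Gamma> \<Longrightarrow> x \<notin> fst ` set \<Gamma> \<Longrightarrow> \<Gamma> \<turnstile> A \<^bold>: \<box> i \<Longrightarrow> wf_ctx ((x, A) # \<Gamma>)"
| T_Sort: "wf_ctx \<Gamma> \<Longrightarrow> \<Gamma> \<turnstile> \<box> i \<^bold>: \<box> (i + 1)"
| T_Var: "wf_ctx \<Gamma> \<Longrightarrow> map_of \<Gamma> x = Some A \<Longrightarrow> \<Gamma> \<turnstile> Free x \<^bold>: A"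
| T_Pi: "\<Gamma> \<turnstile> A \<^bold>: \<box> i \<Longrightarrow> (x, A) # \<Gamma> \<turnstile> B \<^bold>: \<box> j \<Longrightarrow> \<Gamma> \<turnstile> prd x A B \<^bold>: \<box> (max i j)"
| T_Lam: "(x, A) # \<Gamma> \<turnstile> M \<^bold>: B \<Longrightarrow> \<Gamma> \<turnstile> prd x A B \<^bold>: \<box> i \<Longrightarrow> \<Gamma> \<turnstile> lam x A M \<^bold>: prd x A B"
| T_App: "\<Gamma> \<turnstile> M \<^bold>: prd x A B \<Longrightarrow> is_trm B \<Longrightarrow> \<Gamma> \<turnstile> N \<^bold>: A \<Longrightarrow> \<Gamma> \<turnstile> M \<bullet> N \<^bold>: B[x ::= N]"
| T_Conv: "\<Gamma> \<turnstile> M \<^bold>: A \<Longrightarrow> A \<equiv>\<^sub>\<beta> B \<Longrightarrow> \<Gamma> \<turnstile> B \<^bold>: \<box> i \<Longrightarrow> \<Gamma> \<turnstile> M \<^bold>: B"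


section \<open>Parametricity\<close>

type_synonym pctx = "(name \<times> name \<times> name) list"

primrec Var :: "pctx \<Rightarrow> name list" where
  "Var [] = []"
| "Var (t # \<Xi>) = (case t of (x, x', xR) \<Rightarrow> Var \<Xi> @ [x, x', xR])"

definition wf_pctx :: "pctx \<Rightarrow> bool" where
  "wf_pctx \<Xi> \<longleftrightarrow> distinct (Var \<Xi>)"

text \<open>
  In the rules for binders, the bound names are chosen by the variable convention: the extended
  parametricity context is well-formed, so \<open>x\<close>, \<open>x'\<close>, \<open>xR\<close> are pairwise distinct
  and do not occur in \<open>\<Xi>\<close>. Without this, \<open>x = x'\<close> would be possible for a body
  without variables, and the occurrence of \<open>x\<close> in the type of \<open>xR\<close> would be
  captured. Similarly, \<open>f\<close> and \<open>g\<close> are arbitrary fresh names; their types are the two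
  products that are being related.
\<close>

inductive param :: "pctx \<Rightarrow> trm \<Rightarrow> trm \<Rightarrow> trm \<Rightarrow> bool"
  ("_ \<turnstile> _ \<sim> _ because _" [50, 50, 50, 50] 50)
  where
  P_Sort: "a \<noteq> b \<Longrightarrow>
    \<Xi> \<turnstile> \<box> i \<sim> \<box> i because lam a (\<box> i) (lam b (\<box> i) (Free a \<rightarrow>\<^sub>t Free b \<rightarrow>\<^sub>t \<box> i))"
| P_Var: "(x, x', xR) \<in> set \<Xi> \<Longrightarrow> wf_pctx \<Xi> \<Longrightarrow> \<Xi> \<turnstile> Free x \<sim> Free x' because Free xR"
| P_App: "\<Xi> \<turnstile> M \<sim> M' because MR \<Longrightarrow> \<Xi> \<turnstile> N \<sim> N' because NR \<Longrightarrow>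
    \<Xi> \<turnstile> M \<bullet> N \<sim> M' \<bullet> N' because MR \<bullet> N \<bullet> N' \<bullet> NR"
| P_Lam: "wf_pctx ((x, x', xR) # \<Xi>) \<Longrightarrow>
    \<Xi> \<turnstile> A \<sim> A' because AR \<Longrightarrow>
    (x, x', xR) # \<Xi> \<turnstile> M \<sim> M' because MR \<Longrightarrow>
    \<Xi> \<turnstile> lam x A M \<sim> lam x' A' M' because
      lam x A (lam x' A' (lam xR (AR \<bullet> Free x \<bullet> Free x') MR))"
| P_Pi: "wf_pctx ((x, x', xR) # \<Xi>) \<Longrightarrow>
    \<Xi> \<turnstile> A \<sim> A' because AR \<Longrightarrow>
    (x, x', xR) # \<Xi> \<turnstile> B \<sim> B' because BR \<Longrightarrow>
    distinct [f, g, x, x', xR] \<Longrightarrow>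
    {f, g} \<inter> (fv A \<union> fv A' \<union> fv AR \<union> fv B \<union> fv B' \<union> fv BR) = {} \<Longrightarrow>
    \<Xi> \<turnstile> prd x A B \<sim> prd x' A' B' because
      lam f (prd x A B) (lam g (prd x' A' B')
        (prd x A (prd x' A' (prd xR (AR \<bullet> Free x \<bullet> Free x')
          (BR \<bullet> (Free f \<bullet> Free x) \<bullet> (Free g \<bullet> Free x'))))))"

definition admissible :: "ctx \<Rightarrow> pctx \<Rightarrow> bool"  (infix "\<rhd>" 50) where
  "\<Gamma> \<rhd> \<Xi> \<longleftrightarrow> wf_ctx \<Gamma> \<and> wf_pctx \<Xi> \<and>
    (\<forall>x x' xR A A' AR.
      (x, x', xR) \<in> set \<Xi> \<longrightarrow> map_of \<Gamma> x = Some A \<longrightarrow> \<Xi> \<turnstile> A \<sim> A' because AR \<longrightarrow>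
        map_of \<Gamma> x' = Some A' \<and>
        (\<exists>T. map_of \<Gamma> xR = Some T \<and> T \<equiv>\<^sub>\<beta> AR \<bullet> Free x \<bullet> Free x'))"

text \<open>
  Admissibility constrains \<open>x'\<close> and \<open>xR\<close> only if the type of \<open>x\<close> is itself related
  to some term by \<open>\<Xi>\<close>. The following makes explicit that it is. This does not follow from
  \<open>\<Gamma> \<rhd> \<Xi>\<close> and cannot be dropped from the abstraction theorem: if \<open>\<Gamma>\<close> declares
  \<open>B : \<box> 0\<close>, \<open>f : B \<rightarrow>\<^sub>t \<box> 0\<close>, \<open>n : B\<close> and
  \<open>\<Xi>\<close> consists of \<open>(f, f', fR)\<close>, \<open>(n, n', nR)\<close>, then \<open>\<Gamma> \<rhd> \<Xi>\<close> holds
  vacuously and \<open>\<Gamma> \<turnstile> f \<bullet> n \<^bold>: \<box> 0\<close>, but \<open>f'\<close> and \<open>n'\<close> need not even be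
  declared in \<open>\<Gamma>\<close>.
\<close>

definition types_related :: "ctx \<Rightarrow> pctx \<Rightarrow> bool" where
  "types_related \<Gamma> \<Xi> \<longleftrightarrow>
    (\<forall>x x' xR A. (x, x', xR) \<in> set \<Xi> \<longrightarrow> map_of \<Gamma> x = Some A \<longrightarrow>
      (\<exists>A' AR. \<Xi> \<turnstile> A \<sim> A' because AR))"

end

(*
  The relational translation is a function on terms in which bound variables are indices: an index k
  becomes three indices, 3 k + 2 and 3 k + 1 for the two related terms and 3 k for the witness. The
  parametricity judgement is the graph of this function, so the theorem is an induction on typing
  derivations for it. The induction breaks down if a conversion passes through a type that mentions
  variables outside of Xi. Therefore Gamma is first restricted to the variables related by Xi, which
  is possible because a declaration occurring neither in a term nor in its type can be dropped
  (strengthening); this uses confluence and subject reduction.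
*)
theory Submission
  imports Defs
begin

section \<open>Renaming and substitution\<close>

text \<open>A type that occurs only inside the derivation, in a conversion or as the domain of an
  application, may mention a declared name that \<Xi> does not relate. There \<open>p\<close> and
  \<open>r\<close> take arbitrary values, and the translated type need not be typable. In the
  restricted context every name has a partner. Restricting requires the domain of \<Xi> to be closed
  under taking types; \<open>types_related\<close> provides this, since a related term has all its
  names in the domain (\<open>param_tr\<close>).

  Free names and indices are kept apart because their partners differ in nature. Those of a name are
  prescribed by \<Xi>, and the declared type of its witness is only convertible to the expected one.
  Those of a local variable are given by position and have the expected types literally. The binders
  come in the order x, x', x_R, so the witness is innermost (3 k) and the original variable
  outermost (3 k + 2).\<close>

definition up_ren :: "(nat \<Rightarrow> nat) \<Rightarrow> nat \<Rightarrow> nat" where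
  "up_ren \<xi> k = (case k of 0 \<Rightarrow> 0 | Suc j \<Rightarrow> Suc (\<xi> j))"

lemma up_ren_simps [simp]: "up_ren \<xi> 0 = 0" "up_ren \<xi> (Suc k) = Suc (\<xi> k)"
  by (simp_all add: up_ren_def)

text \<open>Names and indices are renamed together because the primed copy of a term changes both
  (\<open>right\<close>).\<close>

primrec ren :: "(name \<Rightarrow> name) \<Rightarrow> (nat \<Rightarrow> nat) \<Rightarrow> trm \<Rightarrow> trm" where
  "ren \<rho> \<xi> (Sort i) = Sort i"
| "ren \<rho> \<xi> (Free x) = Free (\<rho> x)"
| "ren \<rho> \<xi> (Bound k) = Bound (\<xi> k)"
| "ren \<rho> \<xi> (App M N) = App (ren \<rho> \<xi> M) (ren \<rho> \<xi> N)"
| "ren \<rho> \<xi> (Lam A M) = Lam (ren \<rho> \<xi> A) (ren \<rho> (up_ren \<xi>) M)"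
| "ren \<rho> \<xi> (Prd A B) = Prd (ren \<rho> \<xi> A) (ren \<rho> (up_ren \<xi>) B)"

abbreviation shift :: "trm \<Rightarrow> trm" where
  "shift \<equiv> ren (\<lambda>x. x) Suc"

definition scons :: "trm \<Rightarrow> (nat \<Rightarrow> trm) \<Rightarrow> nat \<Rightarrow> trm"  (infixr "\<cdot>" 65) where
  "(N \<cdot> \<sigma>) k = (case k of 0 \<Rightarrow> N | Suc j \<Rightarrow> \<sigma> j)"

lemma scons_simps [simp]: "(N \<cdot> \<sigma>) 0 = N" "(N \<cdot> \<sigma>) (Suc k) = \<sigma> k"
  by (simp_all add: scons_def)

definition up :: "(nat \<Rightarrow> trm) \<Rightarrow> nat \<Rightarrow> trm" where
  "up \<sigma> = Bound 0 \<cdot> (\<lambda>k. shift (\<sigma> k))"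

lemma up_simps [simp]: "up \<sigma> 0 = Bound 0" "up \<sigma> (Suc k) = shift (\<sigma> k)"
  by (simp_all add: up_def)

text \<open>Parallel substitution as in the sigma calculus. Names are substituted too, so that
  closing a name (\<open>close_sub\<close>) and substituting for it (\<open>subst_sub\<close>) are
  both instances.\<close>

primrec sub :: "(name \<Rightarrow> trm) \<Rightarrow> (nat \<Rightarrow> trm) \<Rightarrow> trm \<Rightarrow> trm" where
  "sub \<theta> \<sigma> (Sort i) = Sort i"
| "sub \<theta> \<sigma> (Free x) = \<theta> x"
| "sub \<theta> \<sigma> (Bound k) = \<sigma> k"
| "sub \<theta> \<sigma> (App M N) = App (sub \<theta> \<sigma> M) (sub \<theta> \<sigma> N)"
| "sub \<theta> \<sigma> (Lam A M) = Lam (sub \<theta> \<sigma> A) (sub (\<lambda>x. shift (\<theta> x)) (up \<sigma>) M)"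
| "sub \<theta> \<sigma> (Prd A B) = Prd (sub \<theta> \<sigma> A) (sub (\<lambda>x. shift (\<theta> x)) (up \<sigma>) B)"

abbreviation inst :: "trm \<Rightarrow> trm \<Rightarrow> trm" where
  "inst N M \<equiv> sub Free (N \<cdot> Bound) M"

lemma up_ren_comp: "up_ren \<xi> (up_ren \<xi>' k) = up_ren (\<lambda>k. \<xi> (\<xi>' k)) k"
  by (cases k) auto

lemma up_ren_id: "up_ren (\<lambda>k. k) k = k"
  by (cases k) auto

lemma ren_ren: "ren \<rho> \<xi> (ren \<rho>' \<xi>' M) = ren (\<lambda>x. \<rho> (\<rho>' x)) (\<lambda>k. \<xi> (\<xi>' k)) M"
  by (induction M arbitrary: \<xi> \<xi>') (simp_all add: up_ren_comp[abs_def])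

lemma ren_id [simp]: "ren (\<lambda>x. x) (\<lambda>k. k) M = M"
  by (induction M) (simp_all add: up_ren_id[abs_def])

lemma up_up_ren: "up \<sigma> (up_ren \<xi> k) = up (\<lambda>k. \<sigma> (\<xi> k)) k"
  by (cases k) auto

lemma sub_ren: "sub \<theta> \<sigma> (ren \<rho> \<xi> M) = sub (\<lambda>x. \<theta> (\<rho> x)) (\<lambda>k. \<sigma> (\<xi> k)) M"
  by (induction M arbitrary: \<theta> \<sigma> \<xi>) (simp_all add: up_up_ren[abs_def])

lemma ren_up: "ren \<rho> (up_ren \<xi>) (up \<sigma> k) = up (\<lambda>k. ren \<rho> \<xi> (\<sigma> k)) k"
  by (cases k) (simp_all add: ren_ren)

lemma ren_sub: "ren \<rho> \<xi> (sub \<theta> \<sigma> M) = sub (\<lambda>x. ren \<rho> \<xi> (\<theta> x)) (\<lambda>k. ren \<rho> \<xi> (\<sigma> k)) M"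
proof (induction M arbitrary: \<theta> \<sigma> \<xi>)
  case (Lam A M)
  show ?case by (simp add: Lam ren_up[abs_def] ren_ren)
next
  case (Prd A M)
  show ?case by (simp add: Prd ren_up[abs_def] ren_ren)
qed simp_all

lemma sub_up: "sub (\<lambda>x. shift (\<theta> x)) (up \<sigma>) (up \<sigma>' k) = up (\<lambda>k. sub \<theta> \<sigma> (\<sigma>' k)) k"
  by (cases k) (simp_all add: sub_ren ren_sub)

lemma sub_sub: "sub \<theta> \<sigma> (sub \<theta>' \<sigma>' M) = sub (\<lambda>x. sub \<theta> \<sigma> (\<theta>' x)) (\<lambda>k. sub \<theta> \<sigma> (\<sigma>' k)) M"
proof (induction M arbitrary: \<theta> \<sigma> \<theta>' \<sigma>')
  case (Lam A M)
  show ?case by (simp add: Lam sub_up[abs_def] sub_ren ren_sub)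
next
  case (Prd A M)
  show ?case by (simp add: Prd sub_up[abs_def] sub_ren ren_sub)
qed simp_all

lemma up_Bound: "up (\<lambda>k. Bound (\<xi> k)) = (\<lambda>k. Bound (up_ren \<xi> k))"
  by (rule ext) (case_tac k; simp)

lemma sub_var: "sub (\<lambda>x. Free (\<rho> x)) (\<lambda>k. Bound (\<xi> k)) M = ren \<rho> \<xi> M"
  by (induction M arbitrary: \<xi>) (simp_all add: up_Bound)

lemma up_Bound_id [simp]: "up Bound = Bound"
  using up_Bound[of "\<lambda>k. k"] by (simp add: up_ren_id[abs_def])

lemma sub_id [simp]: "sub Free Bound M = M"
  by (induction M) simp_all

lemma ren_scons: "ren \<rho> \<xi> ((N \<cdot> \<sigma>) k) = (ren \<rho> \<xi> N \<cdot> (\<lambda>k. ren \<rho> \<xi> (\<sigma> k))) k"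
  by (cases k) simp_all

lemma sub_scons: "sub \<theta> \<tau> ((N \<cdot> \<sigma>) k) = (sub \<theta> \<tau> N \<cdot> (\<lambda>k. sub \<theta> \<tau> (\<sigma> k))) k"
  by (cases k) simp_all

lemma scons_up_ren: "(N \<cdot> \<sigma>) (up_ren \<xi> k) = (N \<cdot> (\<lambda>k. \<sigma> (\<xi> k))) k"
  by (cases k) simp_all

lemma sub_scons_up: "sub \<theta> (N \<cdot> \<tau>) (up \<sigma> k) = (N \<cdot> (\<lambda>k. sub \<theta> \<tau> (\<sigma> k))) k"
  by (cases k) (simp_all add: sub_ren)

lemma ren_inst: "ren \<rho> \<xi> (inst N M) = inst (ren \<rho> \<xi> N) (ren \<rho> (up_ren \<xi>) M)"
  by (simp add: ren_sub sub_ren ren_scons[abs_def] scons_up_ren[abs_def])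

lemma sub_inst: "sub \<theta> \<sigma> (inst N M) = inst (sub \<theta> \<sigma> N) (sub (\<lambda>x. shift (\<theta> x)) (up \<sigma>) M)"
  by (simp add: sub_sub sub_ren sub_scons[abs_def] sub_scons_up[abs_def])

lemma inst_shift [simp]: "inst N (shift M) = M"
  by (simp add: sub_ren)

section \<open>Terms without dangling indices\<close>

primrec lc_at :: "nat \<Rightarrow> trm \<Rightarrow> bool" where
  "lc_at n (Sort i) \<longleftrightarrow> True"
| "lc_at n (Free x) \<longleftrightarrow> True"
| "lc_at n (Bound k) \<longleftrightarrow> k < n"
| "lc_at n (App M N) \<longleftrightarrow> lc_at n M \<and> lc_at n N"
| "lc_at n (Lam A M) \<longleftrightarrow> lc_at n A \<and> lc_at (Suc n) M"
| "lc_at n (Prd A B) \<longleftrightarrow> lc_at n A \<and> lc_at (Suc n) B"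

lemma ren_cong:
  "lc_at n M \<Longrightarrow> (\<And>x. x \<in> fv M \<Longrightarrow> \<rho> x = \<rho>' x) \<Longrightarrow> (\<And>k. k < n \<Longrightarrow> \<xi> k = \<xi>' k) \<Longrightarrow>
    ren \<rho> \<xi> M = ren \<rho>' \<xi>' M"
proof (induction M arbitrary: n \<xi> \<xi>')
  case (Lam A M)
  have "up_ren \<xi> k = up_ren \<xi>' k" if "k < Suc n" for k using that Lam.prems by (cases k) auto
  then have "ren \<rho> (up_ren \<xi>) M = ren \<rho>' (up_ren \<xi>') M" using Lam.prems by (intro Lam.IH(2)) auto
  moreover have "ren \<rho> \<xi> A = ren \<rho>' \<xi>' A" using Lam.prems by (intro Lam.IH(1)) auto
  ultimately show ?case by simp
next
  case (Prd A M)
  have "up_ren \<xi> k = up_ren \<xi>' k" if "k < Suc n" for k using that Prd.prems by (cases k) auto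
  then have "ren \<rho> (up_ren \<xi>) M = ren \<rho>' (up_ren \<xi>') M" using Prd.prems by (intro Prd.IH(2)) auto
  moreover have "ren \<rho> \<xi> A = ren \<rho>' \<xi>' A" using Prd.prems by (intro Prd.IH(1)) auto
  ultimately show ?case by simp
next
  case (App M N)
  have "ren \<rho> \<xi> M = ren \<rho>' \<xi>' M" using App.prems by (intro App.IH(1)) auto
  moreover have "ren \<rho> \<xi> N = ren \<rho>' \<xi>' N" using App.prems by (intro App.IH(2)) auto
  ultimately show ?case by simp
qed simp_all

lemma sub_cong:
  "lc_at n M \<Longrightarrow> (\<And>x. x \<in> fv M \<Longrightarrow> \<theta> x = \<theta>' x) \<Longrightarrow> (\<And>k. k < n \<Longrightarrow> \<sigma> k = \<sigma>' k) \<Longrightarrow>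
    sub \<theta> \<sigma> M = sub \<theta>' \<sigma>' M"
proof (induction M arbitrary: n \<theta> \<theta>' \<sigma> \<sigma>')
  case (Lam A M)
  have u: "up \<sigma> k = up \<sigma>' k" if "k < Suc n" for k using that Lam.prems by (cases k) auto
  have "sub \<theta> \<sigma> A = sub \<theta>' \<sigma>' A" using Lam.prems by (intro Lam.IH(1)) auto
  moreover have "sub (\<lambda>x. shift (\<theta> x)) (up \<sigma>) M = sub (\<lambda>x. shift (\<theta>' x)) (up \<sigma>') M"
    using Lam.prems u by (intro Lam.IH(2)) auto
  ultimately show ?case by simp
next
  case (Prd A M)
  have u: "up \<sigma> k = up \<sigma>' k" if "k < Suc n" for k using that Prd.prems by (cases k) auto
  have "sub \<theta> \<sigma> A = sub \<theta>' \<sigma>' A" using Prd.prems by (intro Prd.IH(1)) auto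
  moreover have "sub (\<lambda>x. shift (\<theta> x)) (up \<sigma>) M = sub (\<lambda>x. shift (\<theta>' x)) (up \<sigma>') M"
    using Prd.prems u by (intro Prd.IH(2)) auto
  ultimately show ?case by simp
next
  case (App M N)
  have "sub \<theta> \<sigma> M = sub \<theta>' \<sigma>' M" using App.prems by (intro App.IH(1)) auto
  moreover have "sub \<theta> \<sigma> N = sub \<theta>' \<sigma>' N" using App.prems by (intro App.IH(2)) auto
  ultimately show ?case by simp
qed simp_all

lemma lc_at_mono: "lc_at n M \<Longrightarrow> n \<le> m \<Longrightarrow> lc_at m M"
proof (induction M arbitrary: n m)
  case (Lam A M)
  from Lam.prems Lam.IH(1)[of n m] Lam.IH(2)[of "Suc n" "Suc m"] show ?case by simp
next
  case (Prd A M)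
  from Prd.prems Prd.IH(1)[of n m] Prd.IH(2)[of "Suc n" "Suc m"] show ?case by simp
next
  case (App M N)
  from App.prems App.IH(1)[of n m] App.IH(2)[of n m] show ?case by simp
qed simp_all

lemma ren_closed: "lc_at 0 M \<Longrightarrow> ren (\<lambda>x. x) \<xi> M = M"
  using ren_cong[of 0 M "\<lambda>x. x" "\<lambda>x. x" \<xi> "\<lambda>k. k"] by simp

lemma sub_closed: "lc_at 0 M \<Longrightarrow> sub Free \<sigma> M = M"
  using sub_cong[of 0 M Free Free \<sigma> Bound] by simp

lemma fv_ren: "fv (ren \<rho> \<xi> M) = \<rho> ` fv M"
  by (induction M arbitrary: \<xi>) auto

lemma lc_at_ren: "lc_at n M \<Longrightarrow> (\<And>k. k < n \<Longrightarrow> \<xi> k < m) \<Longrightarrow> lc_at m (ren \<rho> \<xi> M)"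
proof (induction M arbitrary: n m \<xi>)
  case (Lam A M)
  have "up_ren \<xi> k < Suc m" if "k < Suc n" for k using that Lam.prems by (cases k) auto
  with Lam.prems Lam.IH(1)[of n \<xi> m] Lam.IH(2)[of "Suc n" "up_ren \<xi>" "Suc m"] show ?case by simp
next
  case (Prd A M)
  have "up_ren \<xi> k < Suc m" if "k < Suc n" for k using that Prd.prems by (cases k) auto
  with Prd.prems Prd.IH(1)[of n \<xi> m] Prd.IH(2)[of "Suc n" "up_ren \<xi>" "Suc m"] show ?case by simp
next
  case (App M N)
  from App.prems App.IH(1)[of n \<xi> m] App.IH(2)[of n \<xi> m] show ?case by simp
qed auto

lemma lc_at_sub:
  "lc_at n M \<Longrightarrow> (\<And>x. x \<in> fv M \<Longrightarrow> lc_at m (\<theta> x)) \<Longrightarrow> (\<And>k. k < n \<Longrightarrow> lc_at m (\<sigma> k)) \<Longrightarrow>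
    lc_at m (sub \<theta> \<sigma> M)"
proof (induction M arbitrary: n m \<theta> \<sigma>)
  case (Lam A M)
  have "lc_at (Suc m) (up \<sigma> k)" if "k < Suc n" for k
    using that Lam.prems by (cases k) (auto intro: lc_at_ren)
  moreover have "lc_at (Suc m) (shift (\<theta> x))" if "x \<in> fv M" for x
    using that Lam.prems by (auto intro: lc_at_ren)
  ultimately have "lc_at (Suc m) (sub (\<lambda>x. shift (\<theta> x)) (up \<sigma>) M)"
    using Lam.prems by (intro Lam.IH(2)) auto
  with Lam.prems Lam.IH(1)[of n m \<theta> \<sigma>] show ?case by auto
next
  case (Prd A M)
  have "lc_at (Suc m) (up \<sigma> k)" if "k < Suc n" for k
    using that Prd.prems by (cases k) (auto intro: lc_at_ren)
  moreover have "lc_at (Suc m) (shift (\<theta> x))" if "x \<in> fv M" for x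
    using that Prd.prems by (auto intro: lc_at_ren)
  ultimately have "lc_at (Suc m) (sub (\<lambda>x. shift (\<theta> x)) (up \<sigma>) M)"
    using Prd.prems by (intro Prd.IH(2)) auto
  with Prd.prems Prd.IH(1)[of n m \<theta> \<sigma>] show ?case by auto
next
  case (App M N)
  from App.prems App.IH(1)[of n m \<theta> \<sigma>] App.IH(2)[of n m \<theta> \<sigma>] show ?case by simp
qed simp_all

section \<open>Parallel reduction and confluence\<close>

text \<open>Parallel reduction of Tait and Martin-Loef, on raw terms with possibly dangling indices.
  The annotation of a contracted abstraction is discarded.\<close>

inductive pr :: "trm \<Rightarrow> trm \<Rightarrow> bool"  (infix "\<Rrightarrow>" 50) where
  pr_Sort: "Sort i \<Rrightarrow> Sort i"
| pr_Free: "Free x \<Rrightarrow> Free x"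
| pr_Bound: "Bound k \<Rrightarrow> Bound k"
| pr_App: "M \<Rrightarrow> M' \<Longrightarrow> N \<Rrightarrow> N' \<Longrightarrow> App M N \<Rrightarrow> App M' N'"
| pr_Lam: "A \<Rrightarrow> A' \<Longrightarrow> M \<Rrightarrow> M' \<Longrightarrow> Lam A M \<Rrightarrow> Lam A' M'"
| pr_Prd: "A \<Rrightarrow> A' \<Longrightarrow> B \<Rrightarrow> B' \<Longrightarrow> Prd A B \<Rrightarrow> Prd A' B'"
| pr_beta: "M \<Rrightarrow> M' \<Longrightarrow> N \<Rrightarrow> N' \<Longrightarrow> App (Lam A M) N \<Rrightarrow> inst N' M'"

inductive_cases pr_SortE: "Sort i \<Rrightarrow> M"
inductive_cases pr_AppE: "App M N \<Rrightarrow> P"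
inductive_cases pr_LamE: "Lam A M \<Rrightarrow> P"
inductive_cases pr_PrdE: "Prd A B \<Rrightarrow> P"

lemma pr_refl [simp]: "M \<Rrightarrow> M"
  by (induction M) (auto intro: pr.intros)

lemma pr_ren: "M \<Rrightarrow> N \<Longrightarrow> ren \<rho> \<xi> M \<Rrightarrow> ren \<rho> \<xi> N"
  by (induction arbitrary: \<xi> rule: pr.induct) (auto intro: pr.intros simp: ren_inst)

lemma pr_up: "(\<And>k. \<sigma> k \<Rrightarrow> \<sigma>' k) \<Longrightarrow> up \<sigma> k \<Rrightarrow> up \<sigma>' k"
  by (cases k) (auto intro: pr_ren)

lemma pr_sub:
  "M \<Rrightarrow> N \<Longrightarrow> (\<And>x. \<theta> x \<Rrightarrow> \<theta>' x) \<Longrightarrow> (\<And>k. \<sigma> k \<Rrightarrow> \<sigma>' k) \<Longrightarrow> sub \<theta> \<sigma> M \<Rrightarrow> sub \<theta>' \<sigma>' N"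
proof (induction arbitrary: \<theta> \<theta>' \<sigma> \<sigma>' rule: pr.induct)
  case (pr_Lam A A' M M')
  have "sub (\<lambda>x. shift (\<theta> x)) (up \<sigma>) M \<Rrightarrow> sub (\<lambda>x. shift (\<theta>' x)) (up \<sigma>') M'"
    by (rule pr_Lam.IH(2)) (simp_all add: pr_ren pr_up pr_Lam.prems)
  then show ?case using pr_Lam.IH(1)[OF pr_Lam.prems] by (simp add: pr.pr_Lam)
next
  case (pr_Prd A A' M M')
  have "sub (\<lambda>x. shift (\<theta> x)) (up \<sigma>) M \<Rrightarrow> sub (\<lambda>x. shift (\<theta>' x)) (up \<sigma>') M'"
    by (rule pr_Prd.IH(2)) (simp_all add: pr_ren pr_up pr_Prd.prems)
  then show ?case using pr_Prd.IH(1)[OF pr_Prd.prems] by (simp add: pr.pr_Prd)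
next
  case (pr_beta M M' N N' A)
  have "sub (\<lambda>x. shift (\<theta> x)) (up \<sigma>) M \<Rrightarrow> sub (\<lambda>x. shift (\<theta>' x)) (up \<sigma>') M'"
    by (rule pr_beta.IH(1)) (simp_all add: pr_ren pr_up pr_beta.prems)
  then show ?case using pr_beta.IH(2)[OF pr_beta.prems] by (simp add: pr.pr_beta sub_inst)
next
  case (pr_App M M' N N')
  then show ?case by (simp add: pr.pr_App)
qed simp_all

lemma pr_scons: "N \<Rrightarrow> N' \<Longrightarrow> (N \<cdot> Bound) k \<Rrightarrow> (N' \<cdot> Bound) k"
  by (cases k) auto

lemma pr_inst: "M \<Rrightarrow> M' \<Longrightarrow> N \<Rrightarrow> N' \<Longrightarrow> inst N M \<Rrightarrow> inst N' M'"
  by (rule pr_sub) (auto intro: pr_scons)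

text \<open>Complete development of Takahashi: all redexes present are contracted at once. Every
  parallel step can be completed to it (\<open>pr_cd\<close>), which makes it a common target of any
  two steps from the same term.\<close>

fun cd :: "trm \<Rightarrow> trm" where
  "cd (Sort i) = Sort i"
| "cd (Free x) = Free x"
| "cd (Bound k) = Bound k"
| "cd (App (Lam A M) N) = inst (cd N) (cd M)"
| "cd (App M N) = App (cd M) (cd N)"
| "cd (Lam A M) = Lam (cd A) (cd M)"
| "cd (Prd A B) = Prd (cd A) (cd B)"

lemma pr_cd: "M \<Rrightarrow> N \<Longrightarrow> N \<Rrightarrow> cd M"
proof (induction rule: pr.induct)
  case (pr_App M M' N N')
  show ?case
  proof (cases "\<exists>A P. M = Lam A P")
    case True
    then obtain A P where M: "M = Lam A P" by blast
    \<comment> \<open>An abstraction steps only to an abstraction, so the redex survives and can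
      still be contracted.\<close>
    from pr_App M obtain A' P' where "M' = Lam A' P'" by (auto elim: pr_LamE)
    with pr_App M show ?thesis by (auto elim: pr_LamE intro!: pr.pr_beta)
  next
    case False
    then have "cd (App M N) = App (cd M) (cd N)" by (cases M) auto
    with pr_App show ?thesis by (auto intro: pr.intros)
  qed
qed (auto intro: pr.intros pr_inst)

abbreviation prs :: "trm \<Rightarrow> trm \<Rightarrow> bool"  (infix "\<Rrightarrow>\<^sup>*" 50) where
  "prs \<equiv> pr\<^sup>*\<^sup>*"

lemma prs_confluent: "M \<Rrightarrow>\<^sup>* N \<Longrightarrow> M \<Rrightarrow>\<^sup>* P \<Longrightarrow> \<exists>Q. N \<Rrightarrow>\<^sup>* Q \<and> P \<Rrightarrow>\<^sup>* Q"
proof -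
  \<comment> \<open>Strip lemma: one step against many. The general case iterates it along the
    second reduction.\<close>
  have strip: "\<exists>Q. N \<Rrightarrow> Q \<and> P \<Rrightarrow>\<^sup>* Q" if "M \<Rrightarrow>\<^sup>* N" "M \<Rrightarrow> P" for M N P
    using that
  proof (induction)
    case base
    then show ?case by blast
  next
    case (step N N')
    then obtain Q where "N \<Rrightarrow> Q" "P \<Rrightarrow>\<^sup>* Q" by blast
    \<comment> \<open>Both Q and N' step to \<open>cd N\<close>, which is the new common
      reduct.\<close>
    moreover from this have "Q \<Rrightarrow> cd N" by (simp add: pr_cd)
    ultimately show ?case using pr_cd[OF step.hyps(2)] by (meson rtranclp.rtrancl_into_rtrancl)
  qed
  assume "M \<Rrightarrow>\<^sup>* N" and "M \<Rrightarrow>\<^sup>* P"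
  from this(2,1) show "\<exists>Q. N \<Rrightarrow>\<^sup>* Q \<and> P \<Rrightarrow>\<^sup>* Q"
  proof (induction arbitrary: N rule: converse_rtranclp_induct)
    case base
    then show ?case by blast
  next
    case (step M M1)
    then obtain Q where Q: "N \<Rrightarrow> Q" "M1 \<Rrightarrow>\<^sup>* Q" using strip by blast
    then obtain R where "Q \<Rrightarrow>\<^sup>* R" "P \<Rrightarrow>\<^sup>* R" using step.IH by blast
    with Q show ?case by (meson converse_rtranclp_into_rtranclp)
  qed
qed

text \<open>Joinability in place of the generated equivalence: inversion properties such as
  \<open>cv_Prd_inj\<close> are immediate, and confluence goes into transitivity.\<close>

definition cv :: "trm \<Rightarrow> trm \<Rightarrow> bool"  (infix "\<approx>" 50) where
  "M \<approx> N \<longleftrightarrow> (\<exists>P. M \<Rrightarrow>\<^sup>* P \<and> N \<Rrightarrow>\<^sup>* P)"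

lemma prs_map:
  assumes "\<And>M N. M \<Rrightarrow> N \<Longrightarrow> f M \<Rrightarrow> f N" and "M \<Rrightarrow>\<^sup>* N"
  shows "f M \<Rrightarrow>\<^sup>* f N"
  using assms(2) by (induction) (use assms(1) in \<open>auto intro: rtranclp.rtrancl_into_rtrancl\<close>)

lemma prs_map2:
  assumes "\<And>M M' N N'. M \<Rrightarrow> M' \<Longrightarrow> N \<Rrightarrow> N' \<Longrightarrow> f M N \<Rrightarrow> f M' N'"
    and "M \<Rrightarrow>\<^sup>* M'" and "N \<Rrightarrow>\<^sup>* N'"
  shows "f M N \<Rrightarrow>\<^sup>* f M' N'"
proof -
  have "f M N \<Rrightarrow>\<^sup>* f M' N" by (rule prs_map[of "\<lambda>M. f M N"]) (use assms in auto)
  also have "f M' N \<Rrightarrow>\<^sup>* f M' N'" by (rule prs_map[of "f M'"]) (use assms in auto)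
  finally show ?thesis .
qed

lemma prs_Prd: "Prd A B \<Rrightarrow>\<^sup>* C \<Longrightarrow> \<exists>A' B'. C = Prd A' B' \<and> A \<Rrightarrow>\<^sup>* A' \<and> B \<Rrightarrow>\<^sup>* B'"
  by (induction rule: rtranclp_induct)
    (auto elim!: pr_PrdE intro: rtranclp.rtrancl_into_rtrancl)

lemma prs_Sort [simp]: "Sort i \<Rrightarrow>\<^sup>* C \<longleftrightarrow> C = Sort i"
proof
  show "Sort i \<Rrightarrow>\<^sup>* C \<Longrightarrow> C = Sort i"
    by (induction rule: rtranclp_induct) (auto elim!: pr_SortE)
qed simp

lemma cv_refl [simp]: "M \<approx> M"
  by (auto simp: cv_def)

lemma cv_sym: "M \<approx> N \<Longrightarrow> N \<approx> M"
  by (auto simp: cv_def)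

lemma cv_trans [trans]: "M \<approx> N \<Longrightarrow> N \<approx> P \<Longrightarrow> M \<approx> P"
  unfolding cv_def by (meson prs_confluent rtranclp_trans)

lemma prs_cv: "M \<Rrightarrow>\<^sup>* N \<Longrightarrow> M \<approx> N"
  by (auto simp: cv_def)

lemma pr_cv: "M \<Rrightarrow> N \<Longrightarrow> M \<approx> N"
  by (auto intro: prs_cv)

lemma cv_map2:
  assumes "\<And>M M' N N'. M \<Rrightarrow> M' \<Longrightarrow> N \<Rrightarrow> N' \<Longrightarrow> f M N \<Rrightarrow> f M' N'"
    and "M \<approx> M'" and "N \<approx> N'"
  shows "f M N \<approx> f M' N'"
  using assms(2,3) prs_map2[of f, OF assms(1)] unfolding cv_def by meson

lemma cv_App: "M \<approx> M' \<Longrightarrow> N \<approx> N' \<Longrightarrow> App M N \<approx> App M' N'"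
  by (rule cv_map2) (auto intro: pr.intros)

lemma cv_Lam: "M \<approx> M' \<Longrightarrow> N \<approx> N' \<Longrightarrow> Lam M N \<approx> Lam M' N'"
  by (rule cv_map2) (auto intro: pr.intros)

lemma cv_Prd: "M \<approx> M' \<Longrightarrow> N \<approx> N' \<Longrightarrow> Prd M N \<approx> Prd M' N'"
  by (rule cv_map2) (auto intro: pr.intros)

lemma cv_ren: "M \<approx> N \<Longrightarrow> ren \<rho> \<xi> M \<approx> ren \<rho> \<xi> N"
  using cv_map2[of "\<lambda>M _. ren \<rho> \<xi> M"] pr_ren by blast

lemma cv_sub: "M \<approx> N \<Longrightarrow> sub \<theta> \<sigma> M \<approx> sub \<theta> \<sigma> N"
  by (rule cv_map2[of "\<lambda>M _. sub \<theta> \<sigma> M"]) (auto intro: pr_sub)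

lemma cv_inst: "M \<approx> M' \<Longrightarrow> N \<approx> N' \<Longrightarrow> inst N M \<approx> inst N' M'"
  using cv_map2[of "\<lambda>M N. inst N M"] pr_inst by blast

text \<open>Reducts of a product are products of reducts of the components, so a common reduct
  splits.\<close>

lemma cv_Prd_inj: "Prd A B \<approx> Prd A' B' \<Longrightarrow> A \<approx> A' \<and> B \<approx> B'"
  unfolding cv_def by (blast dest: prs_Prd)

lemma cv_beta: "App (Lam A M) N \<approx> inst N M"
  by (rule pr_cv) (auto intro: pr.intros)

section \<open>A typing judgement with indices for local variables\<close>

text \<open>An entry of \<open>E\<close> sees only the entries behind it, so at position k it is
  lifted over itself and the k newer ones.\<close>

definition look :: "trm list \<Rightarrow> nat \<Rightarrow> trm" where
  "look E k = ren (\<lambda>x. x) (\<lambda>n. n + Suc k) (E ! k)"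

lemma look_Cons [simp]: "look (A # E) 0 = shift A" "look (A # E) (Suc k) = shift (look E k)"
  by (simp_all add: look_def ren_ren)

text \<open>Free names are constants with closed types in \<open>G\<close>, local variables are indices into
  \<open>E\<close>. Instead of well-formedness of contexts, the typability of the type of a variable is
  required at each of its occurrences; so a derivation for a type is available in inductions.\<close>

inductive has :: "(name \<Rightarrow> trm option) \<Rightarrow> trm list \<Rightarrow> trm \<Rightarrow> trm \<Rightarrow> bool" for G where
  has_Sort: "has G E (Sort i) (Sort (Suc i))"
| has_Free: "G x = Some A \<Longrightarrow> lc_at 0 A \<Longrightarrow> has G E A (Sort i) \<Longrightarrow> has G E (Free x) A"
| has_Bound: "k < length E \<Longrightarrow> has G E (look E k) (Sort i) \<Longrightarrow> has G E (Bound k) (look E k)"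
| has_Prd: "has G E A (Sort i) \<Longrightarrow> has G (A # E) B (Sort j) \<Longrightarrow> has G E (Prd A B) (Sort (max i j))"
| has_Lam: "has G E A (Sort i) \<Longrightarrow> has G (A # E) B (Sort j) \<Longrightarrow> has G (A # E) M B \<Longrightarrow>
    has G E (Lam A M) (Prd A B)"
| has_App: "has G E A (Sort i) \<Longrightarrow> has G (A # E) B (Sort j) \<Longrightarrow> has G E M (Prd A B) \<Longrightarrow>
    has G E N A \<Longrightarrow> has G E (App M N) (inst N B)"
| has_Conv: "has G E M A \<Longrightarrow> A \<approx> B \<Longrightarrow> has G E B (Sort i) \<Longrightarrow> has G E M B"

text \<open>The guard \<open>lc_at 0 A\<close> mirrors \<open>has_Free\<close>: only names with
  closed types can be typed.\<close>

definition ren_ok where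
  "ren_ok \<rho> \<xi> G E G' E' \<longleftrightarrow>
    (\<forall>x A. G x = Some A \<longrightarrow> lc_at 0 A \<longrightarrow> G' (\<rho> x) = Some (ren \<rho> (\<lambda>k. k) A)) \<and>
    (\<forall>k < length E. \<xi> k < length E' \<and> look E' (\<xi> k) = ren \<rho> \<xi> (look E k))"

lemma ren_ok_up:
  assumes "ren_ok \<rho> \<xi> G E G' E'"
  shows "ren_ok \<rho> (up_ren \<xi>) G (A # E) G' (ren \<rho> \<xi> A # E')"
  unfolding ren_ok_def
proof (intro conjI allI impI)
  fix k assume "k < length (A # E)"
  with assms show "up_ren \<xi> k < length (ren \<rho> \<xi> A # E')"
    and "look (ren \<rho> \<xi> A # E') (up_ren \<xi> k) = ren \<rho> (up_ren \<xi>) (look (A # E) k)"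
    by (cases k; simp add: ren_ok_def ren_ren)+
qed (use assms in \<open>simp add: ren_ok_def\<close>)

lemma has_ren:
  "has G E M A \<Longrightarrow> ren_ok \<rho> \<xi> G E G' E' \<Longrightarrow> has G' E' (ren \<rho> \<xi> M) (ren \<rho> \<xi> A)"
proof (induction arbitrary: E' \<xi> rule: has.induct)
  case (has_Sort E i)
  show ?case by (simp add: has.has_Sort)
next
  case (has_Free x A E i)
  have "has G' E' (ren \<rho> \<xi> A) (Sort i)" using has_Free.IH has_Free.prems by simp
  moreover have "lc_at 0 (ren \<rho> \<xi> A)" using has_Free.hyps(2) by (rule lc_at_ren) simp
  moreover have "ren \<rho> \<xi> A = ren \<rho> (\<lambda>k. k) A" using has_Free.hyps(2) by (rule ren_cong) auto
  ultimately show ?case using has_Free.hyps has_Free.prems by (simp add: has.has_Free ren_ok_def)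
next
  case (has_Bound k E i)
  have "has G' E' (ren \<rho> \<xi> (look E k)) (Sort i)" using has_Bound.IH has_Bound.prems by simp
  then show ?case
    using has_Bound.hyps has_Bound.prems has.has_Bound[of "\<xi> k" E' G' i] by (simp add: ren_ok_def)
next
  case (has_Prd E A i B j)
  then show ?case using ren_ok_up[OF has_Prd.prems] by (simp add: has.has_Prd)
next
  case (has_Lam E A i B j M)
  then show ?case using ren_ok_up[OF has_Lam.prems, of A]
    by (simp add: has.has_Lam[of _ _ _ i _ j])
next
  case (has_App E A i B j M N)
  then show ?case using ren_ok_up[OF has_App.prems, of A]
    by (simp add: has.has_App[of _ _ "ren \<rho> \<xi> A" i _ j] ren_inst)
next
  case (has_Conv E M A B i)
  have "has G' E' (ren \<rho> \<xi> B) (Sort i)" using has_Conv.IH(2)[OF has_Conv.prems] by simp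
  then show ?case using has_Conv.IH(1)[OF has_Conv.prems] has_Conv.hyps(2)
    by (meson has.has_Conv cv_ren)
qed

lemma has_shift: "has G E M A \<Longrightarrow> has G (B # E) (shift M) (shift A)"
  by (erule has_ren) (simp add: ren_ok_def)

lemma has_closed:
  assumes "has G [] M A" and "lc_at 0 M" and "lc_at 0 A"
  shows "has G E M A"
  using has_ren[OF assms(1), of "\<lambda>x. x" "\<lambda>k. k" G E] by (simp add: ren_ok_def)

text \<open>The first two disjuncts serve variables whose type is not known to be typable.\<close>

definition has_or_var where
  "has_or_var G E M A \<longleftrightarrow>
    (\<exists>k < length E. M = Bound k \<and> A = look E k) \<or>
    (\<exists>x. M = Free x \<and> G x = Some A \<and> lc_at 0 A) \<or> has G E M A"

lemma has_or_var_has: "has_or_var G E M A \<Longrightarrow> has G E A (Sort i) \<Longrightarrow> has G E M A"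
  by (auto simp: has_or_var_def intro: has.intros)

lemma has_or_var_shift: "has_or_var G E M A \<Longrightarrow> has_or_var G (B # E) (shift M) (shift A)"
  by (fastforce simp: has_or_var_def ren_closed intro: has_shift)

definition sub_ok where
  "sub_ok \<theta> \<sigma> G E G' E' \<longleftrightarrow>
    (\<forall>x A. G x = Some A \<longrightarrow> lc_at 0 A \<longrightarrow> has_or_var G' E' (\<theta> x) (sub \<theta> \<sigma> A)) \<and>
    (\<forall>k < length E. has_or_var G' E' (\<sigma> k) (sub \<theta> \<sigma> (look E k)))"

lemma sub_shift_up: "sub (\<lambda>x. shift (\<theta> x)) (up \<sigma>) (shift A) = shift (sub \<theta> \<sigma> A)"
  by (simp add: sub_ren ren_sub)

lemma sub_ok_up:
  assumes "sub_ok \<theta> \<sigma> G E G' E'"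
  shows "sub_ok (\<lambda>x. shift (\<theta> x)) (up \<sigma>) G (A # E) G' (sub \<theta> \<sigma> A # E')"
  unfolding sub_ok_def
proof (intro conjI allI impI)
  fix x C assume C: "G x = Some C" "lc_at 0 C"
  then have "has_or_var G' E' (\<theta> x) (sub \<theta> \<sigma> C)" using assms by (simp add: sub_ok_def)
  then have "has_or_var G' (sub \<theta> \<sigma> A # E') (shift (\<theta> x)) (shift (sub \<theta> \<sigma> C))"
    by (rule has_or_var_shift)
  \<comment> \<open>C is closed and hence equal to its own shift.\<close>
  then show "has_or_var G' (sub \<theta> \<sigma> A # E') (shift (\<theta> x)) (sub (\<lambda>x. shift (\<theta> x)) (up \<sigma>) C)"
    using C(2) by (metis sub_shift_up ren_closed)
next
  fix k assume "k < length (A # E)"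
  with assms show "has_or_var G' (sub \<theta> \<sigma> A # E') (up \<sigma> k)
      (sub (\<lambda>x. shift (\<theta> x)) (up \<sigma>) (look (A # E) k))"
    by (cases k) (auto simp: sub_shift_up sub_ok_def has_or_var_shift, auto simp: has_or_var_def)
qed

lemma has_sub:
  "has G E M A \<Longrightarrow> sub_ok \<theta> \<sigma> G E G' E' \<Longrightarrow> has G' E' (sub \<theta> \<sigma> M) (sub \<theta> \<sigma> A)"
proof (induction arbitrary: E' \<theta> \<sigma> rule: has.induct)
  case (has_Sort E i)
  show ?case by (simp add: has.has_Sort)
next
  case (has_Free x A E i)
  then show ?case by (auto simp: sub_ok_def intro: has_or_var_has[of _ _ _ _ i])
next
  case (has_Bound k E i)
  then show ?case by (auto simp: sub_ok_def intro: has_or_var_has[of _ _ _ _ i])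
next
  case (has_Prd E A i B j)
  then show ?case using sub_ok_up[OF has_Prd.prems] by (simp add: has.has_Prd)
next
  case (has_Lam E A i B j M)
  then show ?case using sub_ok_up[OF has_Lam.prems, of A]
    by (simp add: has.has_Lam[of _ _ _ i _ j])
next
  case (has_App E A i B j M N)
  then show ?case using sub_ok_up[OF has_App.prems, of A]
    by (simp add: has.has_App[of _ _ "sub \<theta> \<sigma> A" i _ j] sub_inst)
next
  case (has_Conv E M A B i)
  have "has G' E' (sub \<theta> \<sigma> B) (Sort i)" using has_Conv.IH(2)[OF has_Conv.prems] by simp
  then show ?case using has_Conv.IH(1)[OF has_Conv.prems] has_Conv.hyps(2)
    by (meson has.has_Conv cv_sub)
qed

lemma sub_ok_scons:
  assumes "has_or_var G E' N (sub Free \<sigma> A)"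
    and "\<And>k. k < length E \<Longrightarrow> has_or_var G E' (\<sigma> k) (sub Free \<sigma> (look E k))"
  shows "sub_ok Free (N \<cdot> \<sigma>) G (A # E) G E'"
  unfolding sub_ok_def
proof (intro conjI allI impI)
  fix x C assume "G x = Some C" "lc_at 0 C"
  then show "has_or_var G E' (Free x) (sub Free (N \<cdot> \<sigma>) C)"
    by (simp add: has_or_var_def sub_closed)
next
  fix k assume "k < length (A # E)"
  with assms show "has_or_var G E' ((N \<cdot> \<sigma>) k) (sub Free (N \<cdot> \<sigma>) (look (A # E) k))"
    by (cases k) (simp_all add: sub_ren)
qed

lemma has_inst:
  assumes "has G (A # E) M B" and "has G E N A"
  shows "has G E (inst N M) (inst N B)"
  using assms(1)
  by (rule has_sub, intro sub_ok_scons) (use assms(2) in \<open>simp_all add: has_or_var_def\<close>)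

lemma has_type: "has G E M A \<Longrightarrow> \<exists>i. has G E A (Sort i)"
proof (induction rule: has.induct)
  case (has_App E A i B j M N)
  then show ?case using has_inst[of G A E B "Sort j" N] by auto
qed (auto intro: has.intros)

section \<open>Inversion and subject reduction\<close>

lemma has_Prd_inv:
  "has G E (Prd A B) C \<Longrightarrow>
    \<exists>i j. has G E A (Sort i) \<and> has G (A # E) B (Sort j) \<and> C \<approx> Sort (max i j)"
proof (induction E "Prd A B" C rule: has.induct)
  case (has_Prd E i j)
  then show ?case using cv_refl by blast
next
  case (has_Conv E C D i)
  then show ?case by (meson cv_sym cv_trans)
qed

lemma has_Lam_inv:
  "has G E (Lam A M) C \<Longrightarrow>
    \<exists>i B. has G E A (Sort i) \<and> has G (A # E) M B \<and> C \<approx> Prd A B"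
proof (induction E "Lam A M" C rule: has.induct)
  case (has_Lam E i B j)
  then show ?case using cv_refl by blast
next
  case (has_Conv E C D i)
  then show ?case by (meson cv_sym cv_trans)
qed

text \<open>The typings of A and B that \<open>has_App\<close> demands for the sake of inductions
  are recovered from the product type of M.\<close>

lemma has_app:
  assumes "has G E M (Prd A B)" and "has G E N A"
  shows "has G E (App M N) (inst N B)"
  using assms has_type has_Prd_inv has_App by metis

text \<open>Substitute index 0 for itself: in the new context it has type A by conversion. The
  substitution is the identity, so only the context changes.\<close>

lemma has_conv_ctx:
  assumes "has G (A # E) M B" and "A \<approx> A'" and "has G E A (Sort i)" and "has G E A' (Sort j)"
  shows "has G (A' # E) M B"
proof -
  have "has G (A' # E) (shift A) (Sort i)" and "has G (A' # E) (shift A') (Sort j)"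
    using has_shift[OF assms(3)] has_shift[OF assms(4)] by simp_all
  then have "has G (A' # E) (Bound 0) (shift A)"
    using has_Bound[of 0 "A' # E" G j] has_Conv cv_ren[OF cv_sym[OF assms(2)]] by simp
  then have "sub_ok Free (Bound 0 \<cdot> (\<lambda>k. Bound (Suc k))) G (A # E) G (A' # E)"
    by (intro sub_ok_scons)
      (auto simp: has_or_var_def sub_var[of "\<lambda>x. x" Suc])
  from has_sub[OF assms(1) this] show ?thesis
    using up_Bound_id by (simp add: up_def)
qed

text \<open>Subject reduction. A parallel step may also change a domain or an argument, and with it
  the context or the result type; each case converts back to the original type, whose typability the
  premises of \<open>has\<close> supply.\<close>

lemma has_pr: "has G E M A \<Longrightarrow> M \<Rrightarrow> N \<Longrightarrow> has G E N A"
proof (induction arbitrary: N rule: has.induct)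
  case (has_Prd E A i B j)
  from has_Prd.prems obtain A' B' where N: "N = Prd A' B'" "A \<Rrightarrow> A'" "B \<Rrightarrow> B'"
    by (auto elim: pr_PrdE)
  have "has G (A' # E) B' (Sort j)"
    using has_Prd N by (blast intro: has_conv_ctx pr_cv)
  then show ?case using has_Prd N has.has_Prd by blast
next
  case (has_Lam E A i B j M)
  from has_Lam.prems obtain A' M' where N: "N = Lam A' M'" "A \<Rrightarrow> A'" "M \<Rrightarrow> M'"
    by (auto elim: pr_LamE)
  have A': "has G E A' (Sort i)" using has_Lam N by blast
  then have "has G (A' # E) M' B" and "has G (A' # E) B (Sort j)"
    using has_Lam N by (blast intro: has_conv_ctx pr_cv)+
  then have "has G E (Lam A' M') (Prd A' B)" using A' has.has_Lam by blast
  moreover have "Prd A' B \<approx> Prd A B" using N by (intro cv_Prd cv_sym[OF pr_cv] cv_refl)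
  ultimately show ?case using N has.has_Prd[OF has_Lam.hyps(1,2)] has.has_Conv by blast
next
  case (has_App E A i B j M N P)
  have B: "has G E (inst N B) (Sort j)" using has_inst[OF has_App.hyps(2,4)] by simp
  from has_App.prems consider M' N' where "P = App M' N'" "M \<Rrightarrow> M'" "N \<Rrightarrow> N'"
    | A0 M0 M' N' where "M = Lam A0 M0" "P = inst N' M'" "M0 \<Rrightarrow> M'" "N \<Rrightarrow> N'"
    by (blast elim: pr_AppE)
  then show ?case
  proof cases
    case (1 M' N')
    then have "has G E (App M' N') (inst N' B)" using has_App has.has_App by blast
    moreover have "inst N' B \<approx> inst N B" using 1 by (intro cv_inst cv_sym[OF pr_cv] cv_refl)
    ultimately show ?thesis using 1 B has.has_Conv by blast
  next
    case (2 A0 M0 M' N')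
    \<comment> \<open>The induction hypothesis for the function is applied to the step that reduces
      the body only, so the annotation \<open>A0\<close> stays as it is.\<close>
    then have "has G E (Lam A0 M') (Prd A B)" using has_App.IH(3) by (blast intro: pr.intros pr_refl)
    then obtain k B0 where M': "has G E A0 (Sort k)" "has G (A0 # E) M' B0"
      and c: "Prd A B \<approx> Prd A0 B0" using has_Lam_inv by blast
    \<comment> \<open>The argument fits the annotation because products are injective under
      conversion.\<close>
    have "has G E N' A0"
      using has_App.IH(4) 2 M'(1) c cv_Prd_inj has.has_Conv by blast
    then have "has G E (inst N' M') (inst N' B0)" using M' has_inst by blast
    moreover have "inst N' B0 \<approx> inst N B"
      using cv_inst[of B B0 N N'] 2 cv_Prd_inj[OF c] cv_sym pr_cv by blast
    ultimately show ?thesis using 2 B has.has_Conv by blast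
  qed
next
  case (has_Conv E M A B i)
  then show ?case using has.has_Conv by blast
next
  case (has_Sort E i)
  then show ?case by (auto elim: pr_SortE intro: has.has_Sort)
next
  case (has_Free x A E i)
  from has_Free.prems have "N = Free x" by (cases) auto
  then show ?case using has_Free has.has_Free by blast
next
  case (has_Bound k E i)
  from has_Bound.prems have "N = Bound k" by (cases) auto
  then show ?case using has_Bound has.has_Bound by blast
qed

lemma has_prs: "M \<Rrightarrow>\<^sup>* N \<Longrightarrow> has G E M A \<Longrightarrow> has G E N A"
  by (induction rule: rtranclp_induct) (auto intro: has_pr)

lemma has_red_type:
  assumes "has G E M A" and "A \<Rrightarrow>\<^sup>* B"
  shows "has G E M B"
  using assms has_type has_prs prs_cv has_Conv by metis

text \<open>The declarations outside \<open>D\<close> may occur in the type of \<open>M\<close>, but only in parts that can be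
  reduced away.\<close>

lemma has_strengthen:
  assumes "has G E M A" and "fv M \<subseteq> D" and "\<Union> (fv ` set E) \<subseteq> D"
    and D: "\<And>x A. G x = Some A \<Longrightarrow> x \<in> D \<Longrightarrow> fv A \<subseteq> D"
  shows "\<exists>A'. A \<Rrightarrow>\<^sup>* A' \<and> has (G |` D) E M A'"
  using assms(1-3)
proof (induction rule: has.induct)
  case (has_Sort E i)
  show ?case using has.has_Sort by blast
next
  case (has_Free x A E i)
  then have "has (G |` D) E A (Sort i)" using D by auto
  then have "has (G |` D) E (Free x) A"
    using has_Free.hyps has_Free.prems(1) by (intro has.has_Free[where i = i]) auto
  then show ?case by blast
next
  case (has_Bound k E i)
  have "fv (look E k) \<subseteq> D" using has_Bound.hyps(1) has_Bound.prems nth_mem by (fastforce simp: look_def fv_ren)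
  then have "has (G |` D) E (look E k) (Sort i)" using has_Bound by auto
  then have "has (G |` D) E (Bound k) (look E k)" using has_Bound.hyps(1) has.has_Bound by blast
  then show ?case by blast
next
  case (has_Prd E A i B j)
  then have "has (G |` D) E A (Sort i)" "has (G |` D) (A # E) B (Sort j)"
    by auto
  then show ?case using has.has_Prd by blast
next
  case (has_Lam E A i B j M)
  have A: "has (G |` D) E A (Sort i)" using has_Lam by auto
  obtain B' where B': "B \<Rrightarrow>\<^sup>* B'" "has (G |` D) (A # E) M B'" using has_Lam by auto
  then obtain k where "has (G |` D) (A # E) B' (Sort k)" using has_type by blast
  then have "has (G |` D) E (Lam A M) (Prd A B')" using A B' has.has_Lam by blast
  moreover have "Prd A B \<Rrightarrow>\<^sup>* Prd A B'" using B' by (auto intro: prs_map2 pr.intros)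
  ultimately show ?case by blast
next
  case (has_App E A i B j M N)
  obtain C where "Prd A B \<Rrightarrow>\<^sup>* C" "has (G |` D) E M C" using has_App by auto
  then obtain A1 B1 where M: "A \<Rrightarrow>\<^sup>* A1" "B \<Rrightarrow>\<^sup>* B1" "has (G |` D) E M (Prd A1 B1)"
    using prs_Prd by blast
  obtain A2 where N: "A \<Rrightarrow>\<^sup>* A2" "has (G |` D) E N A2" using has_App by auto
  \<comment> \<open>Function and argument come with different reducts of A; confluence supplies a
    domain they share.\<close>
  obtain A3 where A3: "A1 \<Rrightarrow>\<^sup>* A3" "A2 \<Rrightarrow>\<^sup>* A3" using prs_confluent M N by blast
  have "Prd A1 B1 \<Rrightarrow>\<^sup>* Prd A3 B1" using A3 by (auto intro: prs_map2 pr.intros)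
  then have "has (G |` D) E M (Prd A3 B1)" using M has_red_type by blast
  moreover have "has (G |` D) E N A3" using N A3 has_red_type by blast
  ultimately have "has (G |` D) E (App M N) (inst N B1)" by (rule has_app)
  moreover have "inst N B \<Rrightarrow>\<^sup>* inst N B1"
    using M(2) by (rule prs_map[rotated]) (auto intro: pr_inst)
  ultimately show ?case by blast
next
  case (has_Conv E M A B i)
  then obtain A' where A': "A \<Rrightarrow>\<^sup>* A'" "has (G |` D) E M A'" by blast
  \<comment> \<open>B may mention names outside \<open>D\<close>, so converting to B itself is out
    of reach. A common reduct of A' and B is reached from A' by reduction, which stays within the
    restricted context.\<close>
  then have "A' \<approx> B" using has_Conv.hyps(2) by (meson cv_sym cv_trans prs_cv)
  then obtain C where "A' \<Rrightarrow>\<^sup>* C" "B \<Rrightarrow>\<^sup>* C" unfolding cv_def by blast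
  then show ?case using A' has_red_type by blast
qed

text \<open>Strengthening types M only at a reduct of A. A itself is typed by a sort, which has no
  proper reduct, so A stays typable in the restricted context and conversion leads back to
  it.\<close>

lemma has_restrict:
  assumes "has G E M A" and "fv M \<subseteq> D" and "fv A \<subseteq> D" and "\<Union> (fv ` set E) \<subseteq> D"
    and D: "\<And>x A. G x = Some A \<Longrightarrow> x \<in> D \<Longrightarrow> fv A \<subseteq> D"
  shows "has (G |` D) E M A"
proof -
  obtain i where "has G E A (Sort i)" using assms(1) has_type by blast
  then have A: "has (G |` D) E A (Sort i)"
    using has_strengthen[of G E A "Sort i" D] assms(3,4) D by auto
  obtain A' where "A \<Rrightarrow>\<^sup>* A'" "has (G |` D) E M A'"
    using has_strengthen[OF assms(1,2,4)] D by blast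
  then show ?thesis using A by (meson has_Conv cv_sym prs_cv)
qed

section \<open>The relational translation\<close>

abbreviation left :: "trm \<Rightarrow> trm" where
  "left \<equiv> ren (\<lambda>x. x) (\<lambda>k. 3 * k + 2)"

abbreviation right :: "(name \<Rightarrow> name) \<Rightarrow> trm \<Rightarrow> trm" where
  "right p \<equiv> ren p (\<lambda>k. 3 * k + 1)"

abbreviation shift2 :: "trm \<Rightarrow> trm" where
  "shift2 \<equiv> ren (\<lambda>x. x) (\<lambda>k. k + 2)"

abbreviation shift3 :: "trm \<Rightarrow> trm" where
  "shift3 \<equiv> ren (\<lambda>x. x) (\<lambda>k. k + 3)"

text \<open>The type of \<open>x\<^sub>R\<close> below the binders of x (index 1) and x' (index
  0).\<close>

definition rel_at :: "trm \<Rightarrow> trm" where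
  "rel_at R = App (App (shift2 R) (Bound 1)) (Bound 0)"

definition lam3 :: "trm \<Rightarrow> trm \<Rightarrow> trm \<Rightarrow> trm \<Rightarrow> trm" where
  "lam3 A A' R M = Lam A (Lam (shift A') (Lam (rel_at R) M))"

definition prd3 :: "trm \<Rightarrow> trm \<Rightarrow> trm \<Rightarrow> trm \<Rightarrow> trm" where
  "prd3 A A' R B = Prd A (Prd (shift A') (Prd (rel_at R) B))"

abbreviation up_ren3 where "up_ren3 \<xi> \<equiv> up_ren (up_ren (up_ren \<xi>))"

text \<open>The body below the binders of \<open>f\<close>, \<open>g\<close>, \<open>x\<close>, \<open>x'\<close> and \<open>x\<^sub>R\<close>, which have the
  indices 4 to 0, is \<open>S (f x) (g x')\<close>, where \<open>S\<close> depends on \<open>x\<close>, \<open>x'\<close>, \<open>x\<^sub>R\<close>.\<close>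

definition prd_rel :: "trm \<Rightarrow> trm \<Rightarrow> trm \<Rightarrow> trm \<Rightarrow> trm \<Rightarrow> trm \<Rightarrow> trm" where
  "prd_rel P P' A A' R S = Lam P (Lam (shift P') (prd3 (shift2 A) (shift2 A') (shift2 R)
      (App (App (ren (\<lambda>x. x) (up_ren3 (\<lambda>k. k + 2)) S) (App (Bound 4) (Bound 2)))
        (App (Bound 3) (Bound 1)))))"

text \<open>A local variable \<open>k\<close> becomes three local variables: \<open>3 k + 2\<close> and \<open>3 k + 1\<close>
  for the two related terms and \<open>3 k\<close> for the witness.\<close>

primrec tr :: "(name \<Rightarrow> name) \<Rightarrow> (name \<Rightarrow> name) \<Rightarrow> trm \<Rightarrow> trm" where
  "tr p r (Sort i) = Lam (Sort i) (Lam (Sort i) (Prd (Bound 1) (Prd (Bound 1) (Sort i))))"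
| "tr p r (Free x) = Free (r x)"
| "tr p r (Bound k) = Bound (3 * k)"
| "tr p r (App M N) = App (App (App (tr p r M) (left N)) (right p N)) (tr p r N)"
| "tr p r (Lam A M) = lam3 (left A) (right p A) (tr p r A) (tr p r M)"
| "tr p r (Prd A B) = prd_rel (left (Prd A B)) (right p (Prd A B))
    (left A) (right p A) (tr p r A) (tr p r B)"

section \<open>The translation under renaming and substitution of indices\<close>

lemma triple_cases:
  obtains "n = 0" | "n = Suc 0" | "n = Suc (Suc 0)" | m where "n = Suc (Suc (Suc m))"
  by (metis not0_implies_Suc)

lemma up_simps_num [simp]:
  "up_ren \<xi> (numeral n) = Suc (\<xi> (pred_numeral n))" "up_ren \<xi> 1 = Suc (\<xi> 0)"
  "up \<sigma> (numeral n) = shift (\<sigma> (pred_numeral n))" "up \<sigma> 1 = shift (\<sigma> 0)"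
  by (simp_all add: numeral_eq_Suc)

lemma ren_rel_at: "ren \<rho> (up_ren (up_ren \<xi>)) (rel_at R) = rel_at (ren \<rho> \<xi> R)"
  by (simp add: rel_at_def ren_ren)

lemma ren_prd3: "ren \<rho> \<xi> (prd3 A A' R M) =
    prd3 (ren \<rho> \<xi> A) (ren \<rho> \<xi> A') (ren \<rho> \<xi> R) (ren \<rho> (up_ren3 \<xi>) M)"
  by (simp add: prd3_def ren_rel_at) (simp add: ren_ren)

lemma ren_lam3: "ren \<rho> \<xi> (lam3 A A' R M) =
    lam3 (ren \<rho> \<xi> A) (ren \<rho> \<xi> A') (ren \<rho> \<xi> R) (ren \<rho> (up_ren3 \<xi>) M)"
  by (simp add: lam3_def ren_rel_at) (simp add: ren_ren)

lemma up_ren3_weak: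
  "up_ren3 (up_ren (up_ren \<xi>)) (up_ren3 (\<lambda>k. Suc (Suc k)) n) = up_ren3 (\<lambda>k. Suc (Suc k)) (up_ren3 \<xi> n)"
  by (cases n rule: triple_cases) simp_all

lemma ren_prd_rel: "ren \<rho> \<xi> (prd_rel P P' A A' R S) =
    prd_rel (ren \<rho> \<xi> P) (ren \<rho> \<xi> P') (ren \<rho> \<xi> A) (ren \<rho> \<xi> A') (ren \<rho> \<xi> R)
      (ren \<rho> (up_ren3 \<xi>) S)"
  by (simp add: prd_rel_def ren_prd3 ren_ren up_ren3_weak numeral_eq_Suc)

lemma sub_rel_at: "sub Free (up (up \<sigma>)) (rel_at R) = rel_at (sub Free \<sigma> R)"
  by (simp add: rel_at_def ren_sub sub_ren ren_ren)

lemma sub_shift_up_Free: "sub Free (up \<sigma>) (shift A) = shift (sub Free \<sigma> A)"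
  using sub_shift_up[of Free] by simp

lemma sub_lam3: "sub Free \<sigma> (lam3 A A' R M) =
    lam3 (sub Free \<sigma> A) (sub Free \<sigma> A') (sub Free \<sigma> R) (sub Free (up (up (up \<sigma>))) M)"
  by (simp add: lam3_def sub_rel_at sub_shift_up_Free)

lemma sub_prd3: "sub Free \<sigma> (prd3 A A' R M) =
    prd3 (sub Free \<sigma> A) (sub Free \<sigma> A') (sub Free \<sigma> R) (sub Free (up (up (up \<sigma>))) M)"
  by (simp add: prd3_def sub_rel_at sub_shift_up_Free)

lemma up_up3_weak:
  "up (up (up (up (up \<sigma>)))) (up_ren3 (\<lambda>k. Suc (Suc k)) n) =
    ren (\<lambda>x. x) (up_ren3 (\<lambda>k. Suc (Suc k))) (up (up (up \<sigma>)) n)"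
  by (cases n rule: triple_cases) (simp_all add: ren_ren)

lemma sub_prd_rel: "sub Free \<sigma> (prd_rel P P' A A' R S) =
    prd_rel (sub Free \<sigma> P) (sub Free \<sigma> P') (sub Free \<sigma> A) (sub Free \<sigma> A') (sub Free \<sigma> R)
      (sub Free (up (up (up \<sigma>))) S)"
  by (simp add: prd_rel_def sub_prd3 sub_shift_up_Free)
    (simp add: sub_ren ren_sub up_up3_weak ren_ren numeral_eq_Suc)

text \<open>The block of three indices that represents k moves as a whole to the block of
  \<open>\<xi> k\<close>; positions within the block are kept.\<close>

definition ren3 :: "(nat \<Rightarrow> nat) \<Rightarrow> nat \<Rightarrow> nat" where
  "ren3 \<xi> n = 3 * \<xi> (n div 3) + n mod 3"

lemma div_mod_triple [simp]:
  "Suc (3 * k) div 3 = k" "Suc (3 * k) mod 3 = 1"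
  "Suc (Suc (3 * k)) div 3 = k" "Suc (Suc (3 * k)) mod 3 = 2"
  "(3 + k) div 3 = Suc (k div 3)"
  by presburger+

lemma up_ren3_ren3: "up_ren3 (ren3 \<xi>) = ren3 (up_ren \<xi>)"
proof
  show "up_ren3 (ren3 \<xi>) n = ren3 (up_ren \<xi>) n" for n
    by (cases n rule: triple_cases) (simp_all add: ren3_def)
qed

lemma ren3_Suc: "ren3 Suc = (\<lambda>k. Suc (Suc (Suc k)))"
  by (rule ext) (simp add: ren3_def)

lemma left_ren: "left (ren (\<lambda>x. x) \<xi> M) = ren (\<lambda>x. x) (ren3 \<xi>) (left M)"
  by (simp add: ren_ren ren3_def)

lemma right_ren: "right p (ren (\<lambda>x. x) \<xi> M) = ren (\<lambda>x. x) (ren3 \<xi>) (right p M)"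
  by (simp add: ren_ren ren3_def)

lemma tr_ren: "tr p r (ren (\<lambda>x. x) \<xi> M) = ren (\<lambda>x. x) (ren3 \<xi>) (tr p r M)"
proof (induction M arbitrary: \<xi>)
  case (App M N)
  then show ?case by (simp only: tr.simps ren.simps left_ren right_ren)
next
  case (Lam A M)
  then show ?case by (simp only: tr.simps ren.simps(5) left_ren right_ren ren_lam3 up_ren3_ren3)
next
  case (Prd A B)
  show ?case
    unfolding tr.simps ren_prd_rel up_ren3_ren3 left_ren[symmetric] right_ren[symmetric]
    unfolding ren.simps(6)[of "\<lambda>x. x" \<xi>] tr.simps Prd by (rule refl)
qed (simp_all add: ren3_def)

text \<open>Positions 0, 1, 2 of a block receive the witness, the primed and the original copy of
  the term substituted for the variable of that block.\<close>

definition sub3 :: "(name \<Rightarrow> name) \<Rightarrow> (name \<Rightarrow> name) \<Rightarrow> (nat \<Rightarrow> trm) \<Rightarrow> nat \<Rightarrow> trm" where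
  "sub3 p r \<sigma> n = (if n mod 3 = 0 then tr p r else if n mod 3 = 1 then right p else left) (\<sigma> (n div 3))"

lemma up_sub3: "up (up (up (sub3 p r \<sigma>))) = sub3 p r (up \<sigma>)"
proof
  have [simp]: "4 + k = Suc (Suc (Suc (Suc k)))" "5 + k = Suc (Suc (Suc (Suc (Suc k))))" for k
    by simp_all
  show "up (up (up (sub3 p r \<sigma>))) n = sub3 p r (up \<sigma>) n" for n
    by (cases n rule: triple_cases) (simp_all add: sub3_def tr_ren ren_ren ren3_Suc)
qed

lemma left_sub: "left (sub Free \<sigma> M) = sub Free (sub3 p r \<sigma>) (left M)"
  by (simp add: ren_sub sub_ren sub3_def)

lemma right_sub: "right p (sub Free \<sigma> M) = sub Free (sub3 p r \<sigma>) (right p M)"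
  by (simp add: ren_sub sub_ren sub3_def)

text \<open>The two copies commute with the substitution separately (\<open>left_sub\<close>,
  \<open>right_sub\<close>), and the three binders of the translation lift \<open>sub3\<close> just
  as one source binder lifts the substitution (\<open>up_sub3\<close>).\<close>

lemma tr_sub: "tr p r (sub Free \<sigma> M) = sub Free (sub3 p r \<sigma>) (tr p r M)"
proof (induction M arbitrary: \<sigma>)
  case (App M N)
  then show ?case by (simp only: tr.simps sub.simps left_sub[of _ _ p r] right_sub[of _ _ _ r])
next
  case (Lam A M)
  then show ?case
    by (simp only: tr.simps sub.simps(5) ren.simps(2) left_sub[of _ _ p r] right_sub[of _ _ _ r]
        sub_lam3 up_sub3)
next
  case (Prd A B)
  have [simp]: "sub Free \<sigma> (Prd A B) = Prd (sub Free \<sigma> A) (sub Free (up \<sigma>) B)" for \<sigma> A B by simp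
  show ?case
    unfolding tr.simps sub_prd_rel up_sub3 left_sub[of _ _ p r, symmetric]
      right_sub[of _ _ _ r, symmetric]
    by (simp only: sub.simps(6) ren.simps(2) tr.simps Prd)
qed (simp_all add: sub3_def)

text \<open>The right-hand side has the form produced by contracting a translated abstraction on its
  three arguments (\<open>lam3_beta\<close>); the last argument belongs to the innermost binder and
  comes first.\<close>

lemma tr_inst:
  "tr p r (inst N M) = sub Free (tr p r N \<cdot> right p N \<cdot> left N \<cdot> Bound) (tr p r M)"
proof -
  have "sub3 p r (N \<cdot> Bound) n = (tr p r N \<cdot> right p N \<cdot> left N \<cdot> Bound) n" for n
    by (cases n rule: triple_cases) (auto simp: sub3_def, presburger+)
  then have "sub3 p r (N \<cdot> Bound) = tr p r N \<cdot> right p N \<cdot> left N \<cdot> Bound" by blast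
  then show ?thesis by (simp add: tr_sub)
qed

section \<open>Typing rules for the parts of the translation\<close>

definition rel_ty :: "trm \<Rightarrow> trm \<Rightarrow> nat \<Rightarrow> trm" where
  "rel_ty A A' i = Prd A (Prd (shift A') (Sort i))"

lemma ren_rel_ty [simp]: "ren \<rho> \<xi> (rel_ty A A' i) = rel_ty (ren \<rho> \<xi> A) (ren \<rho> \<xi> A') i"
  by (simp add: rel_ty_def ren_ren)

abbreviation ctx3 :: "trm \<Rightarrow> trm \<Rightarrow> trm \<Rightarrow> trm list \<Rightarrow> trm list" where
  "ctx3 A A' R E \<equiv> rel_at R # shift A' # A # E"

lemma has_Bound_look:
  "k < length E \<Longrightarrow> look E k = A \<Longrightarrow> has G E A (Sort i) \<Longrightarrow> has G E (Bound k) A"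
  using has_Bound by blast

lemma has_Bound0: "has G E A (Sort i) \<Longrightarrow> has G (A # E) (Bound 0) (shift A)"
  using has_shift[of G E A "Sort i" A] by (intro has_Bound_look[where i = i]) auto

text \<open>The two occurrences of \<open>Bound 1\<close> denote different variables: the first
  type, and one binder deeper the second. The product of relations over \<open>Sort i\<close> lives
  one universe higher, hence \<open>Suc i\<close>.\<close>

lemma has_tr_Sort: "has G E (tr p r (Sort i)) (rel_ty (Sort i) (Sort i) (Suc i))"
proof -
  let ?E = "Sort i # Sort i # E"
  have v: "has G ?E (Bound 1) (Sort i)" "has G (Bound 1 # ?E) (Bound 1) (Sort i)"
    by (rule has_Bound_look[where i = "Suc i"]; simp add: has_Sort)+
  have "has G (Bound 1 # ?E) (Prd (Bound 1) (Sort i)) (Sort (Suc i))"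
    using has_Prd[OF v(2) has_Sort[of _ _ i]] by (simp add: max_def)
  from has_Prd[OF v(1) this]
  have "has G ?E (Prd (Bound 1) (Prd (Bound 1) (Sort i))) (Sort (Suc i))" by (simp add: max_def)
  from has_Lam[OF has_Sort has_Sort this]
  show ?thesis
    unfolding tr.simps rel_ty_def ren.simps
    by (rule has_Lam[OF has_Sort has_Prd[OF has_Sort has_Sort]])
qed

lemma inst_sub_up: "inst N (sub Free (up \<sigma>) M) = sub Free (N \<cdot> \<sigma>) M"
  by (simp add: sub_sub sub_scons_up[abs_def])

lemma prs_App: "M \<Rrightarrow>\<^sup>* M' \<Longrightarrow> App M N \<Rrightarrow>\<^sup>* App M' N"
  by (rule prs_map[of "\<lambda>M. App M N"]) (auto intro: pr_App)

lemma pr_beta_refl: "App (Lam A M) N \<Rrightarrow>\<^sup>* inst N M"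
  by (rule r_into_rtranclp, rule pr_beta) simp_all

lemma prs_beta2: "App (App (Lam A (Lam A' M)) N) N' \<Rrightarrow>\<^sup>* sub Free (N' \<cdot> N \<cdot> Bound) M"
proof (rule rtranclp_trans)
  show "App (App (Lam A (Lam A' M)) N) N' \<Rrightarrow>\<^sup>* App (inst N (Lam A' M)) N'"
    by (rule prs_App, rule pr_beta_refl)
  show "App (inst N (Lam A' M)) N' \<Rrightarrow>\<^sup>* sub Free (N' \<cdot> N \<cdot> Bound) M"
    using pr_beta_refl[of "inst N A'" "sub Free (up (N \<cdot> Bound)) M" N'] by (simp add: inst_sub_up)
qed

lemma prs_beta3:
  "App (App (App (Lam A (Lam A' (Lam R M))) N) N') NR \<Rrightarrow>\<^sup>* sub Free (NR \<cdot> N' \<cdot> N \<cdot> Bound) M"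
proof (rule rtranclp_trans)
  show "App (App (App (Lam A (Lam A' (Lam R M))) N) N') NR \<Rrightarrow>\<^sup>*
      App (sub Free (N' \<cdot> N \<cdot> Bound) (Lam R M)) NR"
    by (rule prs_App, rule prs_beta2)
  show "App (sub Free (N' \<cdot> N \<cdot> Bound) (Lam R M)) NR \<Rrightarrow>\<^sup>* sub Free (NR \<cdot> N' \<cdot> N \<cdot> Bound) M"
    using pr_beta_refl[of "sub Free (N' \<cdot> N \<cdot> Bound) R" "sub Free (up (N' \<cdot> N \<cdot> Bound)) M" NR]
    by (simp add: inst_sub_up)
qed

text \<open>This makes the translation of a type a relation: its type, a translated sort applied to
  two types, reduces to \<open>rel_ty\<close>.\<close>

lemma tr_Sort_prs: "App (App (tr p r (Sort i)) A) A' \<Rrightarrow>\<^sup>* rel_ty A A' i"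
  using prs_beta2[of "Sort i" "Sort i" "Prd (Bound 1) (Prd (Bound 1) (Sort i))" A A']
  by (simp add: rel_ty_def)

lemma has_app2:
  assumes "has G E M (Prd A (Prd (shift A') C))" and "has G E N A" and "has G E N' A'"
  shows "has G E (App (App M N) N') (sub Free (N' \<cdot> N \<cdot> Bound) C)"
proof -
  have "has G E (App M N) (Prd A' (sub Free (up (N \<cdot> Bound)) C))"
    using has_app[OF assms(1,2)] by simp
  from has_app[OF this assms(3)] show ?thesis by (simp add: inst_sub_up)
qed

lemma has_relD:
  "has G E R (App (App (tr p r (Sort i)) A) A') \<Longrightarrow> has G E R (rel_ty A A' i)"
  using has_red_type tr_Sort_prs by blast

text \<open>The direction against reduction is a conversion, so the unreduced type has to be typed
  first; for this A and A' must lie in \<open>Sort i\<close>.\<close>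

lemma has_relI:
  assumes "has G E R (rel_ty A A' i)" and "has G E A (Sort i)" and "has G E A' (Sort i)"
  shows "has G E R (App (App (tr p r (Sort i)) A) A')"
proof -
  have "has G E (App (App (tr p r (Sort i)) A) A') (Sort (Suc i))"
    using has_app2[OF has_tr_Sort[unfolded rel_ty_def] assms(2,3)] by simp
  then show ?thesis using assms(1) has_Conv cv_sym[OF prs_cv[OF tr_Sort_prs]] by blast
qed

lemma has_rel_app:
  assumes "has G E R (rel_ty A A' i)" and "has G E M A" and "has G E M' A'"
  shows "has G E (App (App R M) M') (Sort i)"
  using has_app2[OF assms(1)[unfolded rel_ty_def] assms(2,3)] by simp

lemma has_rel_at:
  assumes "has G E R (rel_ty A A' i)" and "has G E A (Sort i)" and "has G E A' (Sort i)"
  shows "has G (shift A' # A # E) (rel_at R) (Sort i)"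
  unfolding rel_at_def
proof (rule has_rel_app)
  show "has G (shift A' # A # E) (shift2 R) (rel_ty (shift2 A) (shift2 A') i)"
    using has_shift[OF has_shift[OF assms(1)]] by (simp add: ren_ren)
  show "has G (shift A' # A # E) (Bound 1) (shift2 A)"
    using has_shift[OF has_Bound0[OF assms(2)]] by (simp add: ren_ren)
  show "has G (shift A' # A # E) (Bound 0) (shift2 A')"
    using has_Bound0[OF has_shift[OF assms(3), simplified]] by (simp add: ren_ren)
qed

text \<open>The three domains all live in \<open>Sort i\<close>, so the nested maxima
  collapse.\<close>

lemma has_prd3:
  assumes "has G E R (rel_ty A A' i)" and "has G E A (Sort i)" and "has G E A' (Sort i)"
    and "has G (ctx3 A A' R E) C (Sort j)"
  shows "has G E (prd3 A A' R C) (Sort (max i j))"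
  using has_Prd[OF assms(2) has_Prd[OF has_shift[OF assms(3), simplified]
      has_Prd[OF has_rel_at[OF assms(1-3)] assms(4)]]]
  by (simp add: prd3_def max_def split: if_splits)

lemma has_lam3:
  assumes "has G E R (rel_ty A A' i)" and "has G E A (Sort i)" and "has G E A' (Sort i)"
    and "has G (ctx3 A A' R E) C (Sort j)" and "has G (ctx3 A A' R E) M C"
  shows "has G E (lam3 A A' R M) (prd3 A A' R C)"
proof -
  note A' = has_shift[OF assms(3), simplified] and R = has_rel_at[OF assms(1-3)]
  show ?thesis unfolding lam3_def prd3_def
    by (rule has_Lam has_Prd assms A' R)+
qed

lemma has_app3:
  assumes "has G E M (prd3 A A' R C)" and "has G E N A" and "has G E N' A'"
    and "has G E NR (App (App R N) N')"
  shows "has G E (App (App (App M N) N') NR) (sub Free (NR \<cdot> N' \<cdot> N \<cdot> Bound) C)"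
proof -
  have "has G E (App (App M N) N')
      (Prd (App (App R N) N') (sub Free (up (N' \<cdot> N \<cdot> Bound)) C))"
    using has_app2[OF assms(1)[unfolded prd3_def] assms(2,3)] by (simp add: rel_at_def sub_ren)
  from has_app[OF this assms(4)] show ?thesis by (simp add: inst_sub_up)
qed

text \<open>Lets instances of bodies by variables be compared by computing on indices, via
  \<open>ren_ren\<close>.\<close>

lemma inst_Bound: "inst (Bound m) M = ren (\<lambda>x. x) (\<lambda>k. case k of 0 \<Rightarrow> m | Suc k \<Rightarrow> k) M"
proof -
  have "(Bound m \<cdot> Bound) k = Bound (case k of 0 \<Rightarrow> m | Suc k \<Rightarrow> k)" for k by (cases k) simp_all
  then have "(Bound m \<cdot> Bound) = (\<lambda>k. Bound (case k of 0 \<Rightarrow> m | Suc k \<Rightarrow> k))" by blast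
  then show ?thesis using sub_var[of "\<lambda>x. x"] by simp
qed

text \<open>S lives over x, x', x_R with indices 2, 1, 0. B sees x as index 2, which is
  \<open>shift2\<close>. B' sees x' as index 1 and has to skip both x' and x on the way to older
  variables, as well as x_R, hence k + 3.\<close>

lemma has_prd_rel:
  assumes R: "has G E R (rel_ty A A' i)" and A: "has G E A (Sort i)" and A': "has G E A' (Sort i)"
    and B: "has G (A # E) B (Sort j)" and B': "has G (A' # E) B' (Sort j)"
    and S: "has G (ctx3 A A' R E) S
      (rel_ty (shift2 B) (ren (\<lambda>x. x) (\<lambda>k. case k of 0 \<Rightarrow> 1 | Suc k \<Rightarrow> k + 3) B') j)"
  shows "has G E (prd_rel (Prd A B) (Prd A' B') A A' R S) (rel_ty (Prd A B) (Prd A' B') (max i j))"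
proof -
  let ?P = "Prd A B" and ?P' = "Prd A' B'"
  let ?E2 = "shift ?P' # ?P # E"
  let ?E5 = "ctx3 (shift2 A) (shift2 A') (shift2 R) ?E2"
  have P: "has G E ?P (Sort (max i j))" and P': "has G E ?P' (Sort (max i j))"
    using A A' B B' by (auto intro: has_Prd)
  have sh2: "has G ?E2 (shift2 M) (shift2 C)" if "has G E M C" for M C
    using has_shift[OF has_shift[OF that]] by (simp add: ren_ren)
  have sh5: "has G ?E5 (ren (\<lambda>x. x) (\<lambda>k. k + 5) M) (ren (\<lambda>x. x) (\<lambda>k. k + 5) C)"
    if "has G E M C" for M C
    using has_shift[OF has_shift[OF has_shift[OF sh2[OF that]]]] by (simp add: ren_ren numeral_eq_Suc)
  have A5: "has G ?E5 (Bound 2) (ren (\<lambda>x. x) (\<lambda>k. k + 5) A)"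
    by (rule has_Bound_look[OF _ _ sh5[OF A, unfolded ren.simps(1)]]) (simp_all add: ren_ren up_ren_comp numeral_eq_Suc)
  have A5': "has G ?E5 (Bound 1) (ren (\<lambda>x. x) (\<lambda>k. k + 5) A')"
    by (rule has_Bound_look[OF _ _ sh5[OF A', unfolded ren.simps(1)]]) (simp_all add: ren_ren up_ren_comp numeral_eq_Suc)
  have P5: "has G ?E5 (Bound 4) (ren (\<lambda>x. x) (\<lambda>k. k + 5) ?P)"
    by (rule has_Bound_look[OF _ _ sh5[OF P, unfolded ren.simps(1)]]) (simp_all add: ren_ren up_ren_comp numeral_eq_Suc)
  have P5': "has G ?E5 (Bound 3) (ren (\<lambda>x. x) (\<lambda>k. k + 5) ?P')"
    by (rule has_Bound_look[OF _ _ sh5[OF P', unfolded ren.simps(1)]]) (simp_all add: ren_ren up_ren_comp numeral_eq_Suc)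
  let ?w = "ren (\<lambda>x. x) (up_ren3 (\<lambda>k. k + 2))"
  have S5: "has G ?E5 (?w S) (?w (rel_ty (shift2 B)
      (ren (\<lambda>x. x) (\<lambda>k. case k of 0 \<Rightarrow> 1 | Suc k \<Rightarrow> k + 3) B') j))"
  proof (rule has_ren[OF S])
    have "ren_ok (\<lambda>x. x) (\<lambda>k. k + 2) G E G ?E2" by (simp add: ren_ok_def ren_ren)
    from ren_ok_up[OF ren_ok_up[OF ren_ok_up[OF this, of A], of "shift A'"], of "rel_at R"]
    show "ren_ok (\<lambda>x. x) (up_ren3 (\<lambda>k. k + 2)) G (ctx3 A A' R E) G ?E5"
      by (simp add: ren_rel_at ren_ren)
  qed
  \<comment> \<open>The type of f x has to be literally the first domain expected by the weakened S.
    Both are renamings of B, so they are compared index by index.\<close>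
  have B5: "inst (Bound 2) (ren (\<lambda>x. x) (up_ren (\<lambda>k. k + 5)) B) = ?w (shift2 B)"
  proof -
    have "(case up_ren (\<lambda>k. k + 5) n of 0 \<Rightarrow> 2 | Suc k \<Rightarrow> k) = up_ren3 (\<lambda>k. k + 2) (n + 2)" for n
      by (cases n) (simp_all add: numeral_eq_Suc)
    then show ?thesis by (simp only: inst_Bound ren_ren)
  qed
  have B5': "inst (Bound 1) (ren (\<lambda>x. x) (up_ren (\<lambda>k. k + 5)) B') =
      ?w (ren (\<lambda>x. x) (\<lambda>k. case k of 0 \<Rightarrow> 1 | Suc k \<Rightarrow> k + 3) B')"
  proof -
    have "(case up_ren (\<lambda>k. k + 5) n of 0 \<Rightarrow> 1 | Suc k \<Rightarrow> k) =
        up_ren3 (\<lambda>k. k + 2) (case n of 0 \<Rightarrow> 1 | Suc k \<Rightarrow> k + 3)" for n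
      by (cases n) (simp_all add: numeral_eq_Suc)
    then show ?thesis by (simp only: inst_Bound ren_ren)
  qed
  have P6: "has G ?E5 (Bound 4) (Prd (ren (\<lambda>x. x) (\<lambda>k. k + 5) A) (ren (\<lambda>x. x) (up_ren (\<lambda>k. k + 5)) B))"
    and P6': "has G ?E5 (Bound 3) (Prd (ren (\<lambda>x. x) (\<lambda>k. k + 5) A') (ren (\<lambda>x. x) (up_ren (\<lambda>k. k + 5)) B'))"
    using P5 P5' by (simp_all only: ren.simps(6))
  have "has G ?E5 (App (App (?w S) (App (Bound 4) (Bound 2))) (App (Bound 3) (Bound 1))) (Sort j)"
    using S5 has_app[OF P6 A5, unfolded B5]
      has_app[OF P6' A5', unfolded B5']
    unfolding ren_rel_ty by (rule has_rel_app)
  from has_prd3[OF _ _ _ this, of i] sh2[OF R] sh2[OF A] sh2[OF A']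
  have "has G ?E2 (prd3 (shift2 A) (shift2 A') (shift2 R)
      (App (App (?w S) (App (Bound 4) (Bound 2))) (App (Bound 3) (Bound 1)))) (Sort (max i j))"
    by simp
  from has_Lam[OF has_shift[OF P', unfolded ren.simps(1)] has_Sort this]
  show ?thesis
    unfolding prd_rel_def rel_ty_def
    by (rule has_Lam[OF P has_Prd[OF has_shift[OF P', unfolded ren.simps(1)] has_Sort]])
qed

lemma add_Suc_numeral:
  "3 + n = Suc (Suc (Suc n))" "4 + n = Suc (Suc (Suc (Suc n)))" "5 + n = Suc (Suc (Suc (Suc (Suc n))))"
  by simp_all

primrec ctx_rel :: "(name \<Rightarrow> name) \<Rightarrow> (name \<Rightarrow> name) \<Rightarrow> trm list \<Rightarrow> trm list" where
  "ctx_rel p r [] = []"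
| "ctx_rel p r (A # E) = ctx3 (left A) (right p A) (tr p r A) (ctx_rel p r E)"

lemma length_ctx_rel [simp]: "length (ctx_rel p r E) = 3 * length E"
  by (induction E) simp_all

text \<open>The witness of a local variable has the applied relation as its type literally. Local
  variables therefore need no conversion, in contrast to the names in
  \<open>param_ok\<close>.\<close>

lemma look_ctx_rel:
  assumes "k < length E"
  shows "look (ctx_rel p r E) (3 * k) =
      App (App (tr p r (look E k)) (Bound (3 * k + 2))) (Bound (3 * k + 1))"
    and "look (ctx_rel p r E) (3 * k + 1) = right p (look E k)"
    and "look (ctx_rel p r E) (3 * k + 2) = left (look E k)"
  using assms
proof (induction E arbitrary: k)
  case (Cons A E)
  {
    case 1
    then show ?case
    proof (cases k)
      case 0
      then show ?thesis by (simp add: tr_ren ren3_Suc rel_at_def ren_ren numeral_2_eq_2)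
    next
      case (Suc j)
      then show ?thesis using Cons.IH(1)[of j] 1 by (simp add: add_Suc_numeral tr_ren ren3_Suc ren_ren)
    qed
  next
    case 2
    then show ?case
    proof (cases k)
      case 0
      then show ?thesis by (simp add: ren_ren add_Suc_numeral)
    next
      case (Suc j)
      then show ?thesis using Cons.IH(2)[of j] 2 by (simp add: add_Suc_numeral ren_ren)
    qed
  next
    case 3
    then show ?case
    proof (cases k)
      case 0
      then show ?thesis by (simp add: ren_ren add_Suc_numeral)
    next
      case (Suc j)
      then show ?thesis using Cons.IH(3)[of j] 3 by (simp add: add_Suc_numeral ren_ren)
    qed
  }
qed simp_all

section \<open>The translation preserves conversion\<close>

lemma cv_lam3: "A \<approx> B \<Longrightarrow> A' \<approx> B' \<Longrightarrow> R \<approx> S \<Longrightarrow> M \<approx> N \<Longrightarrow> lam3 A A' R M \<approx> lam3 B B' S N"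
  unfolding lam3_def rel_at_def by (intro cv_Lam cv_App cv_ren cv_refl)

lemma cv_prd3: "A \<approx> B \<Longrightarrow> A' \<approx> B' \<Longrightarrow> R \<approx> S \<Longrightarrow> M \<approx> N \<Longrightarrow> prd3 A A' R M \<approx> prd3 B B' S N"
  unfolding prd3_def rel_at_def by (intro cv_Prd cv_App cv_ren cv_refl)

lemma cv_prd_rel:
  "P \<approx> Q \<Longrightarrow> P' \<approx> Q' \<Longrightarrow> A \<approx> B \<Longrightarrow> A' \<approx> B' \<Longrightarrow> R \<approx> S \<Longrightarrow> T \<approx> U \<Longrightarrow>
    prd_rel P P' A A' R T \<approx> prd_rel Q Q' B B' S U"
  unfolding prd_rel_def by (intro cv_Lam cv_App cv_prd3 cv_ren cv_refl)

lemma lam3_beta: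
  "App (App (App (lam3 A A' R M) N) N') NR \<Rrightarrow>\<^sup>* sub Free (NR \<cdot> N' \<cdot> N \<cdot> Bound) M"
  unfolding lam3_def by (rule prs_beta3)

text \<open>One contraction becomes three after translation, so a parallel step is matched up to
  conversion only.\<close>

lemma cv_tr: "M \<Rrightarrow> N \<Longrightarrow> tr p r M \<approx> tr p r N"
proof (induction rule: pr.induct)
  case (pr_App M M' N N')
  show ?case unfolding tr.simps
    by (intro cv_App cv_ren pr_App.IH pr_App.hyps[THEN pr_cv])
next
  case (pr_Lam A A' M M')
  show ?case unfolding tr.simps
    by (intro cv_lam3 cv_ren pr_Lam.IH pr_Lam.hyps[THEN pr_cv])
next
  case (pr_Prd A A' B B')
  show ?case unfolding tr.simps
    by (intro cv_prd_rel cv_Prd cv_ren pr_Prd.IH pr_Prd.hyps[THEN pr_cv])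
next
  case (pr_beta M M' N N' A)
  have "tr p r (App (Lam A M) N) \<approx> tr p r (App (Lam A M') N')"
    unfolding tr.simps
    by (intro cv_App cv_lam3 cv_ren pr_beta.IH pr_beta.hyps[THEN pr_cv] cv_refl)
  also have "\<dots> \<approx> tr p r (inst N' M')"
    unfolding tr_inst unfolding tr.simps by (rule prs_cv, rule lam3_beta)
  finally show ?case .
qed simp_all

lemma cv_tr_cv: "M \<approx> N \<Longrightarrow> tr p r M \<approx> tr p r N"
proof -
  have "tr p r M \<approx> tr p r N" if "M \<Rrightarrow>\<^sup>* N" for M N
    using that by induction (auto intro: cv_tr cv_trans)
  then show "M \<approx> N \<Longrightarrow> ?thesis" unfolding cv_def[of M N] using cv_sym cv_trans by meson
qed

lemma prd_rel_prs:
  "App (App (prd_rel P P' A A' R S) M) N \<Rrightarrow>\<^sup>*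
    prd3 A A' R (App (App S (App (shift3 M) (Bound 2))) (App (shift3 N) (Bound 1)))"
proof -
  \<comment> \<open>The weakening of S past f and g is undone when M and N are substituted for
    them.\<close>
  have "up (up (up (N \<cdot> M \<cdot> Bound))) (up_ren3 (\<lambda>k. Suc (Suc k)) n) = Bound n" for n
    by (cases n rule: triple_cases) simp_all
  then have "sub Free (N \<cdot> M \<cdot> Bound) (prd3 (shift2 A) (shift2 A') (shift2 R)
        (App (App (ren (\<lambda>x. x) (up_ren3 (\<lambda>k. k + 2)) S) (App (Bound 4) (Bound 2)))
          (App (Bound 3) (Bound 1)))) =
      prd3 A A' R (App (App S (App (shift3 M) (Bound 2))) (App (shift3 N) (Bound 1)))"
    by (simp add: sub_prd3 sub_ren ren_ren numeral_eq_Suc)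
  then show ?thesis unfolding prd_rel_def by (metis prs_beta2)
qed

section \<open>The abstraction theorem for terms with indices\<close>

lemma ren_ok_left: "(\<And>x A. G x = Some A \<Longrightarrow> lc_at 0 A \<Longrightarrow> H x = Some A) \<Longrightarrow>
    ren_ok (\<lambda>x. x) (\<lambda>k. 3 * k + 2) G E H (ctx_rel p r E)"
  unfolding ren_ok_def using look_ctx_rel(3)[of _ E p r] by auto

lemma ren_ok_right: "(\<And>x A. G x = Some A \<Longrightarrow> lc_at 0 A \<Longrightarrow> H (p x) = Some (ren p (\<lambda>k. k) A)) \<Longrightarrow>
    ren_ok p (\<lambda>k. 3 * k + 1) G E H (ctx_rel p r E)"
  unfolding ren_ok_def using look_ctx_rel(2)[of _ E p r] by auto

text \<open>What admissibility says about the names of G, phrased for total p and r: the type of the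
  primed name is met exactly, the type T of the witness up to conversion. T is asked to be typable
  because \<open>has_Free\<close> demands it.\<close>

definition param_ok where
  "param_ok p r G H \<longleftrightarrow> (\<forall>x A. G x = Some A \<longrightarrow> lc_at 0 A \<longrightarrow>
    H x = Some A \<and> H (p x) = Some (ren p (\<lambda>k. k) A) \<and>
    (\<exists>T i. H (r x) = Some T \<and> lc_at 0 T \<and> has H [] T (Sort i) \<and>
      T \<approx> App (App (tr p r A) (Free x)) (Free (p x))))"

lemma has_left: "param_ok p r G H \<Longrightarrow> has G E M A \<Longrightarrow> has H (ctx_rel p r E) (left M) (left A)"
  by (erule has_ren, rule ren_ok_left) (simp add: param_ok_def)

lemma has_right: "param_ok p r G H \<Longrightarrow> has G E M A \<Longrightarrow> has H (ctx_rel p r E) (right p M) (right p A)"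
  by (erule has_ren, rule ren_ok_right) (simp add: param_ok_def)

text \<open>Stated apart from the induction because the abstraction case also needs the relation of
  its product type.\<close>

lemma has_tr_Prd:
  assumes H: "param_ok p r G H"
    and A: "has G E A (Sort i)" and B: "has G (A # E) B (Sort j)"
    and RA: "has H (ctx_rel p r E) (tr p r A) (rel_ty (left A) (right p A) i)"
    and RB: "has H (ctx_rel p r (A # E)) (tr p r B) (rel_ty (left B) (right p B) j)"
  shows "has H (ctx_rel p r E) (tr p r (Prd A B)) (rel_ty (left (Prd A B)) (right p (Prd A B)) (max i j))"
proof -
  let ?F = "ctx_rel p r E"
  let ?l = "ren (\<lambda>x. x) (up_ren (\<lambda>k. 3 * k + 2)) B" and ?r = "ren p (up_ren (\<lambda>k. 3 * k + 1)) B"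
  have l: "has H ?F (Prd (left A) ?l) (Sort (max i j))" and r: "has H ?F (Prd (right p A) ?r) (Sort (max i j))"
    using has_left[OF H has_Prd[OF A B]] has_right[OF H has_Prd[OF A B]] by simp_all
  have l': "has H (left A # ?F) ?l (Sort j)"
    using has_ren[OF B ren_ok_up[OF ren_ok_left]] H by (simp add: param_ok_def)
  have r': "has H (right p A # ?F) ?r (Sort j)"
    using has_ren[OF B ren_ok_up[OF ren_ok_right]] H by (simp add: param_ok_def)
  have "shift2 ?l = left B"
  proof -
    have "up_ren (\<lambda>k. 3 * k + 2) n + 2 = 3 * n + 2" for n by (cases n) simp_all
    then show ?thesis by (simp only: ren_ren)
  qed
  moreover have "ren (\<lambda>x. x) (\<lambda>k. case k of 0 \<Rightarrow> 1 | Suc k \<Rightarrow> k + 3) ?r = right p B"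
  proof -
    have "(case up_ren (\<lambda>k. 3 * k + 1) n of 0 \<Rightarrow> 1 | Suc k \<Rightarrow> k + 3) = 3 * n + 1" for n
      by (cases n) simp_all
    then show ?thesis by (simp only: ren_ren)
  qed
  ultimately show ?thesis
    using has_prd_rel[OF RA _ _ l' r', of "tr p r B"] has_left[OF H A] has_right[OF H A] RB
    by simp
qed

text \<open>Reynolds' abstraction theorem for \<open>has\<close>. Where the subject is itself a
  type, \<open>has_relD\<close> turns the induction hypothesis into the typing of a relation, which
  then types the expected type of a witness.\<close>

lemma has_tr:
  assumes "has G E M A" and H: "param_ok p r G H"
  shows "has H (ctx_rel p r E) (tr p r M) (App (App (tr p r A) (left M)) (right p M))"
  using assms(1)
proof (induction rule: has.induct)
  case (has_Sort E i)
  show ?case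
    using has_relI[OF has_tr_Sort has.has_Sort has.has_Sort, where p = p and r = r]
    by (simp only: ren.simps(1))
next
  case (has_Free x A E i)
  have x: "has G E (Free x) A" using has_Free.hyps by (rule has.has_Free)
  obtain T j where T: "H (r x) = Some T" "lc_at 0 T" "has H [] T (Sort j)"
      and c: "T \<approx> App (App (tr p r A) (Free x)) (Free (p x))"
    using H has_Free.hyps unfolding param_ok_def by blast
  have "has H (ctx_rel p r E) T (Sort j)" using T by (auto intro: has_closed)
  then have "has H (ctx_rel p r E) (Free (r x)) T" using T has.has_Free by blast
  \<comment> \<open>Converting from the declared type T requires the expected type to be typable.
    This comes from the induction hypothesis for A, which is why \<open>has_Free\<close> carries a
    derivation for A.\<close>
  moreover have "has H (ctx_rel p r E) (App (App (tr p r A) (Free x)) (Free (p x))) (Sort i)"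
    using has_rel_app[OF has_relD[OF has_Free.IH[unfolded ren.simps(1)]] has_left[OF H x] has_right[OF H x]]
    by simp
  ultimately show ?case using c has.has_Conv by simp
next
  case (has_Bound k E i)
  have k: "has G E (Bound k) (look E k)" using has_Bound.hyps by (rule has.has_Bound)
  have "has H (ctx_rel p r E) (App (App (tr p r (look E k)) (left (Bound k))) (right p (Bound k))) (Sort i)"
    using has_rel_app[OF has_relD[OF has_Bound.IH[unfolded ren.simps(1)]] has_left[OF H k] has_right[OF H k]] .
  then have "has H (ctx_rel p r E) (Bound (3 * k))
      (App (App (tr p r (look E k)) (left (Bound k))) (right p (Bound k)))"
    using has_Bound.hyps(1) look_ctx_rel(1)[OF has_Bound.hyps(1), of p r]
    by (intro has_Bound_look) simp_all
  then show ?case by simp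
next
  case (has_Prd E A i B j)
  have AB: "has G E (Prd A B) (Sort (max i j))" using has_Prd.hyps by (rule has.has_Prd)
  note RA = has_relD[OF has_Prd.IH(1)[unfolded ren.simps(1)]]
    and RB = has_relD[OF has_Prd.IH(2)[unfolded ren.simps(1)]]
  from has_tr_Prd[OF H has_Prd.hyps RA RB] has_left[OF H AB] has_right[OF H AB]
  show ?case unfolding ren.simps(1) by (rule has_relI)
next
  case (has_Lam E A i B j M)
  let ?F = "ctx_rel p r E" and ?M = "Lam A M"
  have L: "has G E ?M (Prd A B)" using has_Lam.hyps by (rule has.has_Lam)
  note RA = has_relD[OF has_Lam.IH(1)[unfolded ren.simps(1)]]
    and RB = has_relD[OF has_Lam.IH(2)[unfolded ren.simps(1)]]
  let ?C = "App (App (tr p r B) (left M)) (right p M)"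
  \<comment> \<open>Below the three binders x has index 2, so the lifted original abstraction
    applied to it contracts to its body; likewise the primed one with index 1.\<close>
  have l: "App (shift3 (left ?M)) (Bound 2) \<approx> left M"
  proof -
    have "(case up_ren (\<lambda>k. 3 * k + 2 + 3) n of 0 \<Rightarrow> 2 | Suc k \<Rightarrow> k) = 3 * n + 2" for n
      by (cases n) simp_all
    then have "inst (Bound 2) (ren (\<lambda>x. x) (up_ren (\<lambda>k. 3 * k + 2 + 3)) M) = left M"
      by (simp only: inst_Bound ren_ren)
    moreover have "shift3 (left ?M) = Lam (ren (\<lambda>x. x) (\<lambda>k. 3 * k + 2 + 3) A)
        (ren (\<lambda>x. x) (up_ren (\<lambda>k. 3 * k + 2 + 3)) M)"
      by (subst ren_ren) (rule ren.simps(5))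
    ultimately show ?thesis using cv_beta by metis
  qed
  have r: "App (shift3 (right p ?M)) (Bound 1) \<approx> right p M"
  proof -
    have "(case up_ren (\<lambda>k. 3 * k + 1 + 3) n of 0 \<Rightarrow> 1 | Suc k \<Rightarrow> k) = 3 * n + 1" for n
      by (cases n) simp_all
    then have "inst (Bound 1) (ren p (up_ren (\<lambda>k. 3 * k + 1 + 3)) M) = right p M"
      by (simp only: inst_Bound ren_ren)
    moreover have "shift3 (right p ?M) = Lam (ren p (\<lambda>k. 3 * k + 1 + 3) A)
        (ren p (up_ren (\<lambda>k. 3 * k + 1 + 3)) M)"
      by (subst ren_ren) (rule ren.simps(5))
    ultimately show ?thesis using cv_beta by metis
  qed
  obtain k where C: "has H (ctx_rel p r (A # E)) ?C (Sort k)" using has_Lam.IH(3) has_type by blast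
  then have "has H ?F (tr p r ?M) (prd3 (left A) (right p A) (tr p r A) ?C)"
    using has_lam3[OF RA _ _ _ has_Lam.IH(3)[unfolded ctx_rel.simps]]
      has_left[OF H has_Lam.hyps(1)] has_right[OF H has_Lam.hyps(1)] by simp
  moreover have "prd3 (left A) (right p A) (tr p r A) ?C \<approx>
      App (App (tr p r (Prd A B)) (left ?M)) (right p ?M)"
  proof -
    have "App (App (tr p r (Prd A B)) (left ?M)) (right p ?M) \<approx>
        prd3 (left A) (right p A) (tr p r A) (App (App (tr p r B) (App (shift3 (left ?M)) (Bound 2)))
          (App (shift3 (right p ?M)) (Bound 1)))"
      unfolding tr.simps by (rule prs_cv[OF prd_rel_prs])
    also have "\<dots> \<approx> prd3 (left A) (right p A) (tr p r A) ?C"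
      by (intro cv_prd3 cv_App l r cv_refl)
    finally show ?thesis by (rule cv_sym)
  qed
  moreover have "has H ?F (App (App (tr p r (Prd A B)) (left ?M)) (right p ?M)) (Sort (max i j))"
    using has_tr_Prd[OF H has_Lam.hyps(1,2) RA RB] has_left[OF H L] has_right[OF H L]
    by (rule has_rel_app)
  ultimately show ?case by (rule has.has_Conv)
next
  case (has_App E A i B j M N)
  have red: "App (App (tr p r (Prd A B)) (left M)) (right p M) \<Rrightarrow>\<^sup>*
      prd3 (left A) (right p A) (tr p r A) (App (App (tr p r B) (App (shift3 (left M)) (Bound 2)))
        (App (shift3 (right p M)) (Bound 1)))"
    unfolding tr.simps by (rule prd_rel_prs)
  let ?\<sigma> = "tr p r N \<cdot> right p N \<cdot> left N \<cdot> Bound"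
  \<comment> \<open>The instantiation cancels the shift on both copies of M and replaces the bound x
    and x' by the two copies of N.\<close>
  have \<sigma>: "sub Free ?\<sigma> (shift3 X) = X" "?\<sigma> 2 = left N" "?\<sigma> 1 = right p N" for X
    by (simp_all add: sub_ren numeral_2_eq_2 numeral_3_eq_3)
  from has_app3[OF has_red_type[OF has_App.IH(3) red] has_left[OF H has_App.hyps(4)]
      has_right[OF H has_App.hyps(4)] has_App.IH(4)]
  show ?case
    by (simp only: tr_inst tr.simps(4) ren.simps(4) sub.simps(3,4) \<sigma>)
next
  case (has_Conv E M A B i)
  have M: "has G E M B" using has_Conv.hyps by (rule has.has_Conv)
  have "App (App (tr p r A) (left M)) (right p M) \<approx> App (App (tr p r B) (left M)) (right p M)"
    by (intro cv_App cv_tr_cv has_Conv.hyps cv_refl)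
  moreover have "has H (ctx_rel p r E) (App (App (tr p r B) (left M)) (right p M)) (Sort i)"
    using has_relD[OF has_Conv.IH(2)[unfolded ren.simps(1)]] has_left[OF H M] has_right[OF H M]
    by (rule has_rel_app)
  ultimately show ?case using has_Conv.IH(1) has.has_Conv by blast
qed

section \<open>Terms with named binders\<close>

text \<open>All indices are replaced at once, f listing the names of the local variables and
  \<open>case_nat x f\<close> entering a binder. As f is total, the result is always a proper
  term.\<close>

abbreviation opn :: "(nat \<Rightarrow> name) \<Rightarrow> trm \<Rightarrow> trm" where
  "opn f \<equiv> sub Free (\<lambda>k. Free (f k))"

text \<open>Indices from k on do not occur in M; their images are chosen so that \<open>up\<close>
  leads from the substitution for k to the one for \<open>Suc k\<close>.\<close>

lemma close_sub:
  "lc_at k M \<Longrightarrow>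
    close k x M = sub (Free(x := Bound k)) (\<lambda>i. if i < k then Bound i else Bound (Suc i)) M"
proof (induction M arbitrary: k)
  case (Lam A M)
  have "up (\<lambda>i. if i < k then Bound i else Bound (Suc i)) =
      (\<lambda>i. if i < Suc k then Bound i else Bound (Suc i))"
    by (rule ext, case_tac i) auto
  moreover have "(\<lambda>y. shift ((Free(x := Bound k)) y)) = Free(x := Bound (Suc k))" by auto
  ultimately show ?case using Lam by (simp del: fun_upd_apply)
next
  case (Prd A M)
  have "up (\<lambda>i. if i < k then Bound i else Bound (Suc i)) =
      (\<lambda>i. if i < Suc k then Bound i else Bound (Suc i))"
    by (rule ext, case_tac i) auto
  moreover have "(\<lambda>y. shift ((Free(x := Bound k)) y)) = Free(x := Bound (Suc k))" by auto
  ultimately show ?case using Prd by (simp del: fun_upd_apply)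
qed auto

lemma close_0_sub: "lc_at 0 M \<Longrightarrow> close 0 x M = sub (Free(x := Bound 0)) (\<lambda>k. Bound (Suc k)) M"
  using close_sub[of 0] by simp

lemma subst_sub: "lc_at 0 N \<Longrightarrow> M[x ::= N] = sub (Free(x := N)) Bound M"
proof (induction M)
  case (Lam A M)
  have "(\<lambda>y. shift ((Free(x := N)) y)) = Free(x := N)" using Lam.prems by (auto simp: ren_closed)
  then show ?case using Lam by (simp del: fun_upd_apply)
next
  case (Prd A M)
  have "(\<lambda>y. shift ((Free(x := N)) y)) = Free(x := N)" using Prd.prems by (auto simp: ren_closed)
  then show ?case using Prd by (simp del: fun_upd_apply)
qed auto

lemma lc_at_close: "lc_at k M \<Longrightarrow> lc_at (Suc k) (close k x M)"
  by (induction M arbitrary: k) auto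

lemma fv_close: "fv (close k x M) = fv M - {x}"
  by (induction M arbitrary: k) auto

lemma close_fresh: "x \<notin> fv M \<Longrightarrow> close k x M = M"
  by (induction M arbitrary: k) auto

lemma finite_fv [simp]: "finite (fv M)"
  by (induction M) auto

lemma inst_close:
  assumes "lc_at 0 M" and "lc_at 0 N"
  shows "inst N (close 0 x M) = M[x ::= N]"
proof -
  have "(\<lambda>y. inst N ((Free(x := Bound 0)) y)) = Free(x := N)" by auto
  then show ?thesis using assms by (simp add: close_0_sub subst_sub sub_sub)
qed

lemma ex_lc_at: "\<exists>n. lc_at n M"
proof (induction M)
  case (Bound k)
  show ?case by (auto intro: exI[of _ "Suc k"])
next
  case (App M N)
  then obtain m n where "lc_at m M" "lc_at n N" by blast
  then have "lc_at (max m n) (App M N)" by (auto intro: lc_at_mono)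
  then show ?case by blast
next
  case (Lam M N)
  then obtain m n where "lc_at m M" "lc_at n N" by blast
  then have "lc_at (max m n) (Lam M N)" by (auto intro: lc_at_mono)
  then show ?case by blast
next
  case (Prd M N)
  then obtain m n where "lc_at m M" "lc_at n N" by blast
  then have "lc_at (max m n) (Prd M N)" by (auto intro: lc_at_mono)
  then show ?case by blast
qed auto

lemma lc_at_opn: "lc_at 0 (opn f M)"
  using ex_lc_at[of M] by (auto intro: lc_at_sub)

lemma opn_closed: "lc_at 0 M \<Longrightarrow> opn f M = M"
  by (rule sub_closed)

text \<open>By freshness x stands for index 0 only, so closing it restores exactly that index and
  leaves f in force below a binder.\<close>

lemma close_opn:
  assumes "x \<notin> fv M" and "x \<notin> range f"
  shows "close 0 x (opn (case_nat x f) M) = sub Free (up (\<lambda>k. Free (f k))) M"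
proof -
  obtain n where n: "lc_at n M" using ex_lc_at by blast
  have "sub (Free(x := Bound 0)) (\<lambda>k. Bound (Suc k)) (Free (case_nat x f k)) = up (\<lambda>k. Free (f k)) k" for k
    using assms(2) by (cases k) auto
  then show ?thesis
    unfolding close_0_sub[OF lc_at_opn] sub_sub using assms(1)
    by (intro sub_cong[OF n]) auto
qed

lemma lam_opn:
  "x \<notin> fv M \<Longrightarrow> x \<notin> range f \<Longrightarrow> lam x (opn f A) (opn (case_nat x f) M) = opn f (Lam A M)"
  by (simp add: lam_def close_opn)

lemma prd_opn:
  "x \<notin> fv M \<Longrightarrow> x \<notin> range f \<Longrightarrow> prd x (opn f A) (opn (case_nat x f) M) = opn f (Prd A M)"
  by (simp add: prd_def close_opn)

lemma subst_opn:
  assumes "x \<notin> fv M" and "x \<notin> range f"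
  shows "(opn (case_nat x f) M)[x ::= opn f N] = opn f (inst N M)"
  unfolding inst_close[OF lc_at_opn lc_at_opn, symmetric] close_opn[OF assms] by (simp add: sub_inst)

lemma finite_range_case_nat: "finite (range f) \<Longrightarrow> finite (range (case_nat x f))"
  by (rule finite_subset[of _ "insert x (range f)"]) (auto split: nat.split)

lemma ex_fresh: "finite X \<Longrightarrow> \<exists>x :: name. x \<notin> X"
  by (rule ex_new_if_finite) simp_all

text \<open>Finitely many names in f leave a fresh one for every binder, so the term can be rebuilt
  with the named constructors.\<close>

lemma is_trm_opn: "finite (range f) \<Longrightarrow> is_trm (opn f M)"
proof (induction M arbitrary: f)
  case (Lam A M)
  obtain x where x: "x \<notin> fv M \<union> range f" using ex_fresh[of "fv M \<union> range f"] Lam.prems by auto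
  have "is_trm (lam x (opn f A) (opn (case_nat x f) M))"
    using Lam by (intro is_trm.intros) (auto intro: finite_range_case_nat)
  then show ?case using x lam_opn[of x M f A] by simp
next
  case (Prd A M)
  obtain x where x: "x \<notin> fv M \<union> range f" using ex_fresh[of "fv M \<union> range f"] Prd.prems by auto
  have "is_trm (prd x (opn f A) (opn (case_nat x f) M))"
    using Prd by (intro is_trm.intros) (auto intro: finite_range_case_nat)
  then show ?case using x prd_opn[of x M f A] by simp
qed (auto intro: is_trm.intros)

lemma is_trm_iff: "is_trm M \<longleftrightarrow> lc_at 0 M"
proof
  show "is_trm M \<Longrightarrow> lc_at 0 M"
    by (induction rule: is_trm.induct) (auto simp: lam_def prd_def lc_at_close)
  \<comment> \<open>A closed term is its own opening; the constant 0 is a dummy with finite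
    range.\<close>
  show "lc_at 0 M \<Longrightarrow> is_trm M"
    using is_trm_opn[of "\<lambda>_. 0" M] by (simp add: opn_closed)
qed

lemma lc_lam [simp]: "lc_at 0 (lam x A M) \<longleftrightarrow> lc_at 0 A \<and> lc_at (Suc 0) (close 0 x M)"
  and lc_prd [simp]: "lc_at 0 (prd x A M) \<longleftrightarrow> lc_at 0 A \<and> lc_at (Suc 0) (close 0 x M)"
  by (simp_all add: lam_def prd_def)

section \<open>Conversion of named terms agrees with joinability\<close>

lemma beta_lc: "M \<rightarrow>\<^sub>\<beta> N \<Longrightarrow> lc_at 0 M \<and> lc_at 0 N"
proof (induction rule: beta.induct)
  case (beta A M N x)
  then have "lc_at 0 (M[x ::= N])" by (auto simp: is_trm_iff subst_sub intro!: lc_at_sub)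
  then show ?case using beta by (simp add: is_trm_iff lc_at_close)
qed (auto simp: is_trm_iff lc_at_close)

lemma pr_close: "M \<Rrightarrow> N \<Longrightarrow> lc_at 0 M \<Longrightarrow> lc_at 0 N \<Longrightarrow> close 0 x M \<Rrightarrow> close 0 x N"
  by (simp add: close_0_sub pr_sub)

lemma beta_pr: "M \<rightarrow>\<^sub>\<beta> N \<Longrightarrow> M \<Rrightarrow> N"
proof (induction rule: beta.induct)
  case (beta A M N x)
  then have "App (Lam A (close 0 x M)) N \<Rrightarrow> inst N (close 0 x M)" by (intro pr_beta) simp_all
  then show ?case using beta by (simp add: lam_def inst_close is_trm_iff)
next
  case (Lam2 A M M' x)
  then have "close 0 x M \<Rrightarrow> close 0 x M'" using beta_lc pr_close by blast
  then show ?case by (simp add: lam_def pr_Lam)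
next
  case (Pi2 A M M' x)
  then have "close 0 x M \<Rrightarrow> close 0 x M'" using beta_lc pr_close by blast
  then show ?case by (simp add: prd_def pr_Prd)
qed (auto simp: lam_def prd_def intro: pr.intros)

lemma conv_cv: "M \<equiv>\<^sub>\<beta> N \<Longrightarrow> M \<approx> N"
proof (induction rule: equivclp_induct)
  case (step N P)
  then have "N \<approx> P" using beta_pr pr_cv cv_sym by blast
  with step.IH show ?case by (rule cv_trans)
qed simp

lemma betas_map:
  assumes "beta\<^sup>*\<^sup>* M N" and "\<And>M N. M \<rightarrow>\<^sub>\<beta> N \<Longrightarrow> f M \<rightarrow>\<^sub>\<beta> f N"
  shows "beta\<^sup>*\<^sup>* (f M) (f N)"
  using assms(1) by induction (auto intro: assms(2) rtranclp.rtrancl_into_rtrancl)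

lemma betas_lc: "beta\<^sup>*\<^sup>* M N \<Longrightarrow> is_trm M \<Longrightarrow> is_trm N"
  by (induction rule: rtranclp_induct) (auto simp: is_trm_iff dest: beta_lc)

lemma betas_App:
  assumes "beta\<^sup>*\<^sup>* M M'" "beta\<^sup>*\<^sup>* N N'" "is_trm M" "is_trm N"
  shows "beta\<^sup>*\<^sup>* (App M N) (App M' N')"
  using betas_map[OF assms(1), of "\<lambda>M. App M N"] betas_map[OF assms(2), of "App M'"]
    betas_lc[OF assms(1,3)] assms(4) beta.App1 beta.App2 by (meson rtranclp_trans)

lemma betas_lam:
  assumes "beta\<^sup>*\<^sup>* M M'" "beta\<^sup>*\<^sup>* N N'" "is_trm M" "is_trm N"
  shows "beta\<^sup>*\<^sup>* (lam x M N) (lam x M' N')"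
  using betas_map[OF assms(1), of "\<lambda>M. lam x M N"] betas_map[OF assms(2), of "lam x M'"]
    betas_lc[OF assms(1,3)] assms(4) beta.Lam1 beta.Lam2 by (meson rtranclp_trans)

lemma betas_prd:
  assumes "beta\<^sup>*\<^sup>* M M'" "beta\<^sup>*\<^sup>* N N'" "is_trm M" "is_trm N"
  shows "beta\<^sup>*\<^sup>* (prd x M N) (prd x M' N')"
  using betas_map[OF assms(1), of "\<lambda>M. prd x M N"] betas_map[OF assms(2), of "prd x M'"]
    betas_lc[OF assms(1,3)] assms(4) beta.Pi1 beta.Pi2 by (meson rtranclp_trans)

text \<open>Dangling indices are opened by f because beta relates proper terms only. A redex is
  first reduced inside; its contraction is then a beta step by \<open>subst_opn\<close>.\<close>

lemma pr_betas: "M \<Rrightarrow> N \<Longrightarrow> finite (range f) \<Longrightarrow> beta\<^sup>*\<^sup>* (opn f M) (opn f N)"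
proof (induction arbitrary: f rule: pr.induct)
  case (pr_App M M' N N')
  then show ?case by (auto intro!: betas_App is_trm_opn)
next
  case (pr_Lam A A' M M')
  obtain x where x: "x \<notin> fv M \<union> fv M' \<union> range f"
    using ex_fresh[of "fv M \<union> fv M' \<union> range f"] pr_Lam.prems by auto
  have "beta\<^sup>*\<^sup>* (lam x (opn f A) (opn (case_nat x f) M)) (lam x (opn f A') (opn (case_nat x f) M'))"
    using pr_Lam by (intro betas_lam is_trm_opn) (auto intro: finite_range_case_nat)
  then show ?case using x lam_opn[of x M f A] lam_opn[of x M' f A'] by simp
next
  case (pr_Prd A A' M M')
  obtain x where x: "x \<notin> fv M \<union> fv M' \<union> range f"
    using ex_fresh[of "fv M \<union> fv M' \<union> range f"] pr_Prd.prems by auto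
  have "beta\<^sup>*\<^sup>* (prd x (opn f A) (opn (case_nat x f) M)) (prd x (opn f A') (opn (case_nat x f) M'))"
    using pr_Prd by (intro betas_prd is_trm_opn) (auto intro: finite_range_case_nat)
  then show ?case using x prd_opn[of x M f A] prd_opn[of x M' f A'] by simp
next
  case (pr_beta M M' N N' A)
  obtain x where x: "x \<notin> fv M \<union> fv M' \<union> range f"
    using ex_fresh[of "fv M \<union> fv M' \<union> range f"] pr_beta.prems by auto
  let ?f = "case_nat x f"
  have t: "is_trm (opn f A)" "is_trm (opn ?f M)" "is_trm (opn ?f M')" "is_trm (opn f N)" "is_trm (opn f N')"
    using pr_beta.prems by (auto intro: is_trm_opn finite_range_case_nat)
  have "beta\<^sup>*\<^sup>* (App (lam x (opn f A) (opn ?f M)) (opn f N)) (App (lam x (opn f A) (opn ?f M')) (opn f N'))"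
    using t pr_beta by (intro betas_App betas_lam is_trm.intros) (auto intro: finite_range_case_nat)
  moreover have "App (lam x (opn f A) (opn ?f M')) (opn f N') \<rightarrow>\<^sub>\<beta> opn f (inst N' M')"
    using beta.beta[OF t(1,3,5), of x] subst_opn[of x M' f N'] x by simp
  ultimately have "beta\<^sup>*\<^sup>* (App (lam x (opn f A) (opn ?f M)) (opn f N)) (opn f (inst N' M'))"
    by (rule rtranclp.rtrancl_into_rtrancl)
  then show ?case using x lam_opn[of x M f A] by simp
qed auto

lemma cv_conv:
  assumes "M \<approx> N" and "lc_at 0 M" and "lc_at 0 N"
  shows "M \<equiv>\<^sub>\<beta> N"
proof -
  \<comment> \<open>M and N are closed and unaffected by the opening, while the terms on the way,
    whose closedness is not tracked, become proper.\<close>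
  let ?f = "\<lambda>_. 0 :: name"
  have *: "opn ?f M \<equiv>\<^sub>\<beta> opn ?f N" if "M \<Rrightarrow>\<^sup>* N" for M N
    using that
  proof induction
    case (step N P)
    then have "beta\<^sup>*\<^sup>* (opn ?f N) (opn ?f P)" by (intro pr_betas) auto
    then have "opn ?f N \<equiv>\<^sub>\<beta> opn ?f P" by (rule rtranclp_into_equivclp)
    with step.IH show ?case by (rule equivclp_trans)
  qed simp
  from assms(1) obtain P where "M \<Rrightarrow>\<^sup>* P" "N \<Rrightarrow>\<^sup>* P" unfolding cv_def by blast
  then have "opn ?f M \<equiv>\<^sub>\<beta> opn ?f N" using * equivclp_sym equivclp_trans by meson
  then show ?thesis using assms(2,3) by (simp add: opn_closed)
qed

section \<open>Correspondence of the typing judgements\<close>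

lemma has_fv: "has G E M A \<Longrightarrow> fv M \<subseteq> dom G \<and> lc_at (length E) M"
  by (induction rule: has.induct) auto

lemma typing_wf: "\<Gamma> \<turnstile> M \<^bold>: A \<Longrightarrow> wf_ctx \<Gamma>"
  by (induction rule: wf_ctx_typing.inducts(2)[where ?P1.0 = "\<lambda>_. True"])
    (auto elim: wf_ctx.cases)

lemma wf_ConsD: "wf_ctx ((x, A) # \<Gamma>) \<Longrightarrow> wf_ctx \<Gamma> \<and> x \<notin> fst ` set \<Gamma> \<and> (\<exists>i. \<Gamma> \<turnstile> A \<^bold>: \<box> i)"
  by (auto elim: wf_ctx.cases)

text \<open>Names form a flat map in \<open>has\<close>, so each type is checked in the whole
  context rather than in the part declared before it.\<close>

definition typed_ctx :: "ctx \<Rightarrow> bool" where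
  "typed_ctx \<Gamma> \<longleftrightarrow> (\<forall>x A. map_of \<Gamma> x = Some A \<longrightarrow> (\<exists>i. has (map_of \<Gamma>) [] A (Sort i)))"

lemma typed_ctxD:
  assumes "typed_ctx \<Gamma>" and "map_of \<Gamma> x = Some A"
  shows "lc_at 0 A" and "fv A \<subseteq> dom (map_of \<Gamma>)"
proof -
  obtain i where "has (map_of \<Gamma>) [] A (Sort i)" using assms unfolding typed_ctx_def by blast
  from has_fv[OF this] show "lc_at 0 A" "fv A \<subseteq> dom (map_of \<Gamma>)" by simp_all
qed

text \<open>The substitution lemma with x sent to index 0. The types of the other names are left
  alone, because they are typed without x.\<close>

lemma has_close:
  assumes "has (map_of ((x, A) # \<Gamma>)) [] M C"
    and \<Gamma>: "typed_ctx \<Gamma>" and x: "x \<notin> fst ` set \<Gamma>" and A: "has (map_of \<Gamma>) [] A (Sort i)"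
    and C: "lc_at 0 C"
  shows "has (map_of \<Gamma>) [A] (close 0 x M) (close 0 x C)"
proof -
  have x': "map_of \<Gamma> x = None" using x by (simp add: map_of_eq_None_iff)
  have id: "sub (Free(x := Bound 0)) (\<lambda>k. Bound (Suc k)) D = D" if "lc_at 0 D" "x \<notin> fv D" for D
  proof -
    have "sub (Free(x := Bound 0)) (\<lambda>k. Bound (Suc k)) D = sub Free Bound D"
      using that by (intro sub_cong) auto
    then show ?thesis by simp
  qed
  have A': "lc_at 0 A" "x \<notin> fv A" using has_fv[OF A] x' by auto
  have "sub_ok (Free(x := Bound 0)) (\<lambda>k. Bound (Suc k)) (map_of ((x, A) # \<Gamma>)) [] (map_of \<Gamma>) [A]"
    unfolding sub_ok_def
  proof (intro conjI allI impI)
    fix y D assume D: "map_of ((x, A) # \<Gamma>) y = Some D" "lc_at 0 D"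
    show "has_or_var (map_of \<Gamma>) [A] ((Free(x := Bound 0)) y)
        (sub (Free(x := Bound 0)) (\<lambda>k. Bound (Suc k)) D)"
    proof (cases "y = x")
      case True
      then show ?thesis using D A' id[of A] by (simp add: has_or_var_def ren_closed)
    next
      case False
      then have "map_of \<Gamma> y = Some D" using D by simp
      moreover from typed_ctxD[OF \<Gamma> this] have "x \<notin> fv D" using x' by auto
      ultimately show ?thesis using False D id[of D] by (simp add: has_or_var_def)
    qed
  qed simp
  from has_sub[OF assms(1) this] show ?thesis
    using has_fv[OF assms(1)] C by (simp add: close_0_sub)
qed

lemma typing_has:
  shows "wf_ctx \<Gamma> \<Longrightarrow> typed_ctx \<Gamma>"
    and "\<Gamma> \<turnstile> M \<^bold>: A \<Longrightarrow> typed_ctx \<Gamma> \<and> has (map_of \<Gamma>) [] M A"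
proof (induction rule: wf_ctx_typing.inducts)
  case wf_Nil
  show ?case by (simp add: typed_ctx_def)
next
  case (wf_Cons \<Gamma> x A i)
  have ext: "has (map_of ((x, A) # \<Gamma>)) [] B (Sort j)" if "has (map_of \<Gamma>) [] B (Sort j)" for B j
  proof -
    have "map_of \<Gamma> x = None" using wf_Cons by (simp add: map_of_eq_None_iff)
    then have "ren_ok (\<lambda>x. x) (\<lambda>k. k) (map_of \<Gamma>) [] (map_of ((x, A) # \<Gamma>)) []"
      by (auto simp: ren_ok_def)
    from has_ren[OF that this] show ?thesis by simp
  qed
  show ?case unfolding typed_ctx_def
  proof (intro allI impI)
    fix y B assume "map_of ((x, A) # \<Gamma>) y = Some B"
    then have "\<exists>j. has (map_of \<Gamma>) [] B (Sort j)"
      using wf_Cons by (auto simp: typed_ctx_def split: if_splits)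
    then show "\<exists>j. has (map_of ((x, A) # \<Gamma>)) [] B (Sort j)" using ext by blast
  qed
next
  case (T_Sort \<Gamma> i)
  then show ?case using has_Sort by simp
next
  case (T_Var \<Gamma> x A)
  then show ?case using typed_ctxD(1)[of \<Gamma> x A] has_Free unfolding typed_ctx_def by blast
next
  case (T_Pi \<Gamma> A i x B j)
  have "x \<notin> fst ` set \<Gamma>" using T_Pi.hyps(2) typing_wf wf_ConsD by blast
  then have "has (map_of \<Gamma>) [A] (close 0 x B) (Sort j)"
    using has_close[OF conjunct2[OF T_Pi.IH(2)], of i] T_Pi.IH(1) by simp
  then show ?case using T_Pi.IH by (auto simp: prd_def intro: has_Prd)
next
  case (T_Lam x A \<Gamma> M B i)
  have x: "x \<notin> fst ` set \<Gamma>" using T_Lam.hyps(1) typing_wf wf_ConsD by blast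
  obtain k l where AB: "has (map_of \<Gamma>) [] A (Sort k)" "has (map_of \<Gamma>) [A] (close 0 x B) (Sort l)"
    using T_Lam.IH(2) has_Prd_inv unfolding prd_def by blast
  obtain m where "has (map_of ((x, A) # \<Gamma>)) [] B (Sort m)" using T_Lam.IH(1) has_type by blast
  then have "lc_at 0 B" using has_fv by fastforce
  then have "has (map_of \<Gamma>) [A] (close 0 x M) (close 0 x B)"
    using has_close[OF conjunct2[OF T_Lam.IH(1)] conjunct1[OF T_Lam.IH(2)] x AB(1)] by simp
  then show ?case using T_Lam.IH AB by (auto simp: lam_def prd_def intro: has_Lam)
next
  case (T_App \<Gamma> M x A B N)
  have "has (map_of \<Gamma>) [] (App M N) (inst N (close 0 x B))"
    using T_App.IH by (intro has_app[of _ _ _ A]) (simp_all add: prd_def)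
  moreover have "lc_at 0 N" using T_App.IH(2) has_fv by fastforce
  ultimately show ?case using T_App by (simp add: inst_close is_trm_iff)
next
  case (T_Conv \<Gamma> M A B i)
  then show ?case using has_Conv conv_cv by blast
qed

lemma map_of_opn:
  assumes "\<And>k. k < length E \<Longrightarrow> map_of \<Gamma> (f k) = Some (opn f (look E k))"
    and "x \<notin> range f" and "k < length (A # E)"
  shows "map_of ((x, opn f A) # \<Gamma>) (case_nat x f k) = Some (opn (case_nat x f) (look (A # E) k))"
  using assms by (cases k) (auto simp: sub_ren)

text \<open>Local variables are realised by names that \<Gamma> already declares at the opened
  types; a binder adds a fresh name, available since f has finite range.\<close>

lemma has_typing:
  assumes "has G E M A" and "wf_ctx \<Gamma>" and "finite (range f)"
    and "\<And>x A. G x = Some A \<Longrightarrow> lc_at 0 A \<Longrightarrow> map_of \<Gamma> x = Some A"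
    and "\<And>k. k < length E \<Longrightarrow> map_of \<Gamma> (f k) = Some (opn f (look E k))"
  shows "\<Gamma> \<turnstile> opn f M \<^bold>: opn f A"
  using assms
proof (induction arbitrary: \<Gamma> f rule: has.induct)
  case (has_Sort E i)
  then show ?case using T_Sort by simp
next
  case (has_Free x A E i)
  then show ?case by (simp add: T_Var opn_closed)
next
  case (has_Bound k E i)
  then show ?case by (simp add: T_Var)
next
  case (has_Prd E A i B j)
  obtain x where x: "x \<notin> fv B \<union> range f \<union> fst ` set \<Gamma>"
    using ex_fresh[of "fv B \<union> range f \<union> fst ` set \<Gamma>"] has_Prd.prems by auto
  let ?\<Gamma> = "(x, opn f A) # \<Gamma>"
  have A: "\<Gamma> \<turnstile> opn f A \<^bold>: \<box> i" using has_Prd.IH(1)[OF has_Prd.prems] by simp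
  then have wf: "wf_ctx ?\<Gamma>" using has_Prd.prems x by (auto intro: wf_Cons)
  have ext: "map_of ?\<Gamma> y = Some C" if "G y = Some C" "lc_at 0 C" for y C
  proof -
    have "map_of \<Gamma> x = None" using x by (simp add: map_of_eq_None_iff)
    then show ?thesis using has_Prd.prems(3)[OF that] by auto
  qed
  have "map_of ?\<Gamma> (case_nat x f k) = Some (opn (case_nat x f) (look (A # E) k))"
    if "k < length (A # E)" for k
    using map_of_opn[OF has_Prd.prems(4) _ that] x by blast
  from has_Prd.IH(2)[OF wf finite_range_case_nat[OF has_Prd.prems(2)] ext this]
  have "?\<Gamma> \<turnstile> opn (case_nat x f) B \<^bold>: \<box> j" by simp
  from T_Pi[OF A this] show ?case using prd_opn[of x B f A] x by simp
next
  case (has_Lam E A i B j M)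
  obtain x where x: "x \<notin> fv B \<union> fv M \<union> range f \<union> fst ` set \<Gamma>"
    using ex_fresh[of "fv B \<union> fv M \<union> range f \<union> fst ` set \<Gamma>"] has_Lam.prems by auto
  let ?\<Gamma> = "(x, opn f A) # \<Gamma>"
  have A: "\<Gamma> \<turnstile> opn f A \<^bold>: \<box> i" using has_Lam.IH(1)[OF has_Lam.prems] by simp
  then have wf: "wf_ctx ?\<Gamma>" using has_Lam.prems x by (auto intro: wf_Cons)
  have ext: "map_of ?\<Gamma> y = Some C" if "G y = Some C" "lc_at 0 C" for y C
  proof -
    have "map_of \<Gamma> x = None" using x by (simp add: map_of_eq_None_iff)
    then show ?thesis using has_Lam.prems(3)[OF that] by auto
  qed
  have "map_of ?\<Gamma> (case_nat x f k) = Some (opn (case_nat x f) (look (A # E) k))"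
    if "k < length (A # E)" for k
    using map_of_opn[OF has_Lam.prems(4) _ that] x by blast
  note IH = has_Lam.IH(2,3)[OF wf finite_range_case_nat[OF has_Lam.prems(2)] ext this]
  have B: "?\<Gamma> \<turnstile> opn (case_nat x f) B \<^bold>: \<box> j"
    and M: "?\<Gamma> \<turnstile> opn (case_nat x f) M \<^bold>: opn (case_nat x f) B"
    using IH by simp_all
  from T_Lam[OF M T_Pi[OF A B]] show ?case
    using prd_opn[of x B f A] lam_opn[of x M f A] x by simp
next
  case (has_App E A i B j M N)
  obtain x where x: "x \<notin> fv B \<union> range f" using ex_fresh[of "fv B \<union> range f"] has_App.prems by auto
  have "\<Gamma> \<turnstile> opn f M \<^bold>: opn f (Prd A B)" and N: "\<Gamma> \<turnstile> opn f N \<^bold>: opn f A"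
    using has_App.IH(3,4)[OF has_App.prems] by blast+
  then have "\<Gamma> \<turnstile> opn f M \<^bold>: prd x (opn f A) (opn (case_nat x f) B)"
    using prd_opn[of x B f A] x by simp
  from T_App[OF this _ N] show ?case
    using subst_opn[of x B f N] x by (simp add: is_trm_iff lc_at_opn)
next
  case (has_Conv E M A B i)
  have "opn f A \<equiv>\<^sub>\<beta> opn f B" using has_Conv.hyps(2) by (intro cv_conv cv_sub lc_at_opn)
  with has_Conv.IH[OF has_Conv.prems] show ?case using T_Conv by simp
qed

section \<open>The parametricity judgement computes the translation\<close>

text \<open>If p sent another name of M to x', closing x' would capture it; the premise excludes
  that.\<close>

lemma close_ren_upd:
  "x' \<notin> p ` (fv M - {x}) \<Longrightarrow> close (\<xi> k) x' (ren (p(x := x')) \<xi> M) = ren p \<xi> (close k x M)"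
proof (induction M arbitrary: \<xi> k)
  case (Lam A M)
  have "x' \<notin> p ` (fv A - {x})" "x' \<notin> p ` (fv M - {x})" using Lam.prems by auto
  then show ?case using Lam.IH(1)[of \<xi> k] Lam.IH(2)[of "up_ren \<xi>" "Suc k"] by simp
next
  case (Prd A M)
  have "x' \<notin> p ` (fv A - {x})" "x' \<notin> p ` (fv M - {x})" using Prd.prems by auto
  then show ?case using Prd.IH(1)[of \<xi> k] Prd.IH(2)[of "up_ren \<xi>" "Suc k"] by simp
next
  case (App M N)
  have "x' \<notin> p ` (fv M - {x})" "x' \<notin> p ` (fv N - {x})" using App.prems by auto
  then show ?case using App.IH[of \<xi> k] by simp
qed auto

lemma close_ren: "close (\<xi> k) x (ren (\<lambda>x. x) \<xi> M) = ren (\<lambda>x. x) \<xi> (close k x M)"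
  using close_ren_upd[of x "\<lambda>x. x" M x \<xi> k] by (simp add: fun_upd_idem)

lemma close_shift [simp]: "close (Suc k) x (shift M) = shift (close k x M)"
  by (rule close_ren)

lemma close_rel_at: "close (Suc (Suc k)) x (rel_at R) = rel_at (close k x R)"
  using close_ren[of "\<lambda>k. k + 2" k x R] by (simp add: rel_at_def)

lemma close_lam3: "close k x (lam3 A A' R M) =
    lam3 (close k x A) (close k x A') (close k x R) (close (k + 3) x M)"
  by (simp add: lam3_def close_rel_at numeral_3_eq_3)

lemma close_prd3: "close k x (prd3 A A' R M) =
    prd3 (close k x A) (close k x A') (close k x R) (close (k + 3) x M)"
  by (simp add: prd3_def close_rel_at numeral_3_eq_3)

lemma close_prd_rel: "close k x (prd_rel P P' A A' R S) =
    prd_rel (close k x P) (close k x P') (close k x A) (close k x A') (close k x R) (close (k + 3) x S)"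
proof -
  have "close (Suc (Suc k)) x (shift2 M) = shift2 (close k x M)" for M
    using close_ren[of "\<lambda>k. k + 2" k x M] by simp
  moreover have "close (Suc (Suc k) + 3) x (ren (\<lambda>x. x) (up_ren3 (\<lambda>k. k + 2)) S) =
      ren (\<lambda>x. x) (up_ren3 (\<lambda>k. k + 2)) (close (k + 3) x S)"
    using close_ren[of "up_ren3 (\<lambda>k. k + 2)" "k + 3" x S] by (simp add: numeral_3_eq_3)
  ultimately show ?thesis by (simp add: prd_rel_def close_prd3)
qed

text \<open>Counterpart of \<open>close k x\<close> on the translated side, where k source binders
  have become 3 k.\<close>

definition close3 :: "nat \<Rightarrow> name \<Rightarrow> name \<Rightarrow> name \<Rightarrow> trm \<Rightarrow> trm" where
  "close3 k x x' xR M = close (3 * k + 2) x (close (3 * k + 1) x' (close (3 * k) xR M))"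

lemma close3_left:
  "x' \<notin> fv M \<Longrightarrow> xR \<notin> fv M \<Longrightarrow> close3 k x x' xR (left M) = left (close k x M)"
  unfolding close3_def using close_ren[of "\<lambda>k. 3 * k + 2" k x M] by (simp add: close_fresh fv_ren)

lemma close3_right:
  assumes "{x, x', xR} \<inter> p ` (fv M - {x}) = {}" and "distinct [x, x', xR]"
  shows "close3 k x x' xR (right (p(x := x')) M) = right p (close k x M)"
proof -
  have "xR \<notin> fv (right (p(x := x')) M)" "x \<notin> fv (right p (close k x M))"
    using assms by (auto simp: fv_ren fv_close)
  moreover have "close (3 * k + 1) x' (right (p(x := x')) M) = right p (close k x M)"
    using assms by (intro close_ren_upd) auto
  ultimately show ?thesis by (simp add: close3_def close_fresh)
qed

text \<open>A translated binder adds three indices, so passing to a body moves \<open>close3\<close>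
  from k to \<open>Suc k\<close>. The disjointness premises prevent another name of M, or its image
  under p or r, from being bound along with the triple.\<close>

lemma close3_tr:
  assumes "distinct [x, x', xR]"
    and "{x', xR} \<inter> fv M = {}"
    and "{x, x', xR} \<inter> (p ` (fv M - {x}) \<union> r ` (fv M - {x})) = {}"
  shows "close3 k x x' xR (tr (p(x := x')) (r(x := xR)) M) = tr p r (close k x M)"
  using assms(2,3)
proof (induction M arbitrary: k)
  case (Sort i)
  show ?case by (simp add: close3_def)
next
  case (Free y)
  then show ?case using assms(1) by (auto simp: close3_def)
next
  case (Bound i)
  show ?case by (simp add: close3_def)
next
  case (App M N)
  have c: "close3 k x x' xR (App M N) = App (close3 k x x' xR M) (close3 k x x' xR N)" for M N
    by (simp add: close3_def)
  have "close3 k x x' xR (left N) = left (close k x N)"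
    using App.prems by (intro close3_left) auto
  moreover have "close3 k x x' xR (right (p(x := x')) N) = right p (close k x N)"
    using App.prems assms(1) by (intro close3_right) auto
  moreover have "close3 k x x' xR (tr (p(x := x')) (r(x := xR)) M) = tr p r (close k x M)"
    "close3 k x x' xR (tr (p(x := x')) (r(x := xR)) N) = tr p r (close k x N)"
    using App.prems by (intro App.IH; auto)+
  ultimately show ?case by (simp only: tr.simps close.simps c)
next
  case (Lam A M)
  have c: "close3 k x x' xR (lam3 A A' R M) =
      lam3 (close3 k x x' xR A) (close3 k x x' xR A') (close3 k x x' xR R) (close3 (Suc k) x x' xR M)"
    for A A' R M
    by (simp add: close3_def close_lam3 add.commute)
  have "close3 k x x' xR (left A) = left (close k x A)"
    using Lam.prems by (intro close3_left) auto
  moreover have "close3 k x x' xR (right (p(x := x')) A) = right p (close k x A)"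
    using Lam.prems assms(1) by (intro close3_right) auto
  moreover have "close3 k x x' xR (tr (p(x := x')) (r(x := xR)) A) = tr p r (close k x A)"
    "close3 (Suc k) x x' xR (tr (p(x := x')) (r(x := xR)) M) = tr p r (close (Suc k) x M)"
    using Lam.prems by (intro Lam.IH; auto)+
  ultimately show ?case by (simp only: tr.simps close.simps c)
next
  case (Prd A B)
  have c: "close3 k x x' xR (prd_rel P P' A A' R S) =
      prd_rel (close3 k x x' xR P) (close3 k x x' xR P') (close3 k x x' xR A) (close3 k x x' xR A')
        (close3 k x x' xR R) (close3 (Suc k) x x' xR S)" for P P' A A' R S
    by (simp add: close3_def close_prd_rel add.commute)
  have "close3 k x x' xR (left M) = left (close k x M)" if "M = A \<or> M = Prd A B" for M
    using Prd.prems that by (intro close3_left) auto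
  moreover have "close3 k x x' xR (right (p(x := x')) M) = right p (close k x M)"
    if "M = A \<or> M = Prd A B" for M
    using Prd.prems assms(1) that by (intro close3_right) auto
  moreover have "close3 k x x' xR (tr (p(x := x')) (r(x := xR)) A) = tr p r (close k x A)"
    "close3 (Suc k) x x' xR (tr (p(x := x')) (r(x := xR)) B) = tr p r (close (Suc k) x B)"
    using Prd.prems by (intro Prd.IH; auto)+
  ultimately show ?case by (simp only: tr.simps c close.simps(6) simp_thms)
qed

section \<open>Translated binders written with names\<close>

lemma lc_at_shift: "lc_at n M \<Longrightarrow> lc_at (Suc n) (shift M)"
  by (rule lc_at_ren) auto

lemma lc_at_rel_at: "lc_at n R \<Longrightarrow> lc_at (Suc (Suc n)) (rel_at R)"
  by (auto simp: rel_at_def intro: lc_at_ren)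

lemma lc_at_lam3: "lc_at n A \<Longrightarrow> lc_at n A' \<Longrightarrow> lc_at n R \<Longrightarrow> lc_at (n + 3) M \<Longrightarrow>
    lc_at n (lam3 A A' R M)"
  by (simp add: lam3_def lc_at_shift lc_at_rel_at numeral_3_eq_3)

lemma lc_at_prd3: "lc_at n A \<Longrightarrow> lc_at n A' \<Longrightarrow> lc_at n R \<Longrightarrow> lc_at (n + 3) M \<Longrightarrow>
    lc_at n (prd3 A A' R M)"
  by (simp add: prd3_def lc_at_shift lc_at_rel_at numeral_3_eq_3)

lemma up_ren3_less: "k < n + 3 \<Longrightarrow> up_ren3 (\<lambda>k. k + 2) k < n + 5"
  by (cases k rule: triple_cases) auto

lemma lc_at_prd_rel:
  assumes "lc_at n P" "lc_at n P'" "lc_at n A" "lc_at n A'" "lc_at n R" "lc_at (n + 3) S"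
  shows "lc_at n (prd_rel P P' A A' R S)"
proof -
  have "lc_at (Suc (Suc n)) (shift2 M)" if "lc_at n M" for M
    by (rule lc_at_ren[OF that]) simp
  moreover have "lc_at (Suc (Suc n) + 3) (ren (\<lambda>x. x) (up_ren3 (\<lambda>k. k + 2)) S)"
    by (rule lc_at_ren[OF assms(6)]) (use up_ren3_less[of _ n] in \<open>simp add: add.commute\<close>)
  ultimately show ?thesis
    unfolding prd_rel_def using assms by (simp add: lc_at_shift) (intro lc_at_prd3; simp)
qed

lemma lc_at_tr: "lc_at n M \<Longrightarrow> lc_at (3 * n) (tr p r M)"
proof (induction M arbitrary: n)
  case (App M N)
  then show ?case by (auto intro!: lc_at_ren)
next
  case (Lam A M)
  from Lam.prems Lam.IH(1)[of n] Lam.IH(2)[of "Suc n"] show ?case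
    by (auto intro!: lc_at_lam3 lc_at_ren[of n] simp: add.commute)
next
  case (Prd A M)
  have "lc_at (3 * n) (left (Prd A M))" "lc_at (3 * n) (right p (Prd A M))"
    by (rule lc_at_ren[OF Prd.prems]; simp)+
  with Prd.prems Prd.IH(1)[of n] Prd.IH(2)[of "Suc n"] show ?case
    unfolding tr.simps by (intro lc_at_prd_rel) (auto intro!: lc_at_ren[of n] simp: add.commute)
qed auto

lemma fv_tr: "fv (tr p r M) \<subseteq> fv M \<union> p ` fv M \<union> r ` fv M"
  by (induction M) (auto simp: lam3_def prd3_def prd_rel_def rel_at_def fv_ren)

lemma close_rel:
  assumes "lc_at 0 R" and "{x, x'} \<inter> fv R = {}" and "x \<noteq> x'"
  shows "close (Suc 0) x (close 0 x' (App (App R (Free x)) (Free x'))) = rel_at R"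
  using assms by (simp add: close_fresh rel_at_def ren_closed)

text \<open>Freshness excludes capture of x in A' and of x, x' in R; being closed, both equal their
  shifts.\<close>

lemma lam3_named:
  assumes "lc_at 0 A'" and "x \<notin> fv A'"
    and "lc_at 0 R" and "{x, x'} \<inter> fv R = {}" and "x \<noteq> x'"
  shows "lam x A (lam x' A' (lam xR (App (App R (Free x)) (Free x')) M)) = lam3 A A' R (close3 0 x x' xR M)"
  using close_rel[OF assms(3-5)] assms(1,2)
  by (simp add: lam_def lam3_def close3_def close_fresh ren_closed numeral_2_eq_2)

lemma prd3_named:
  assumes "lc_at 0 A'" and "x \<notin> fv A'"
    and "lc_at 0 R" and "{x, x'} \<inter> fv R = {}" and "x \<noteq> x'"
  shows "prd x A (prd x' A' (prd xR (App (App R (Free x)) (Free x')) M)) = prd3 A A' R (close3 0 x x' xR M)"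
  using close_rel[OF assms(3-5)] assms(1,2)
  by (simp add: prd_def prd3_def close3_def close_fresh ren_closed numeral_2_eq_2)

lemma fv_close3: "fv (close3 k x x' xR M) = fv M - {x, x', xR}"
  by (auto simp: close3_def fv_close)

lemma prd_rel_named:
  assumes "lc_at 0 P'" and "lc_at 0 A" and "lc_at 0 A'" and "lc_at 0 R"
    and S: "close3 0 x x' xR BR = S" "lc_at 3 S"
    and x: "distinct [f, g, x, x', xR]" "x \<notin> fv A'" "{x, x'} \<inter> fv R = {}"
    and f: "{f, g} \<inter> (fv P' \<union> fv A \<union> fv A' \<union> fv R \<union> fv BR) = {}"
  shows "lam f P (lam g P' (prd x A (prd x' A' (prd xR (App (App R (Free x)) (Free x'))
      (App (App BR (App (Free f) (Free x))) (App (Free g) (Free x'))))))) = prd_rel P P' A A' R S"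
proof -
  let ?C = "App (App BR (App (Free f) (Free x))) (App (Free g) (Free x'))"
  have C: "close3 0 x x' xR ?C = App (App S (App (Free f) (Bound 2))) (App (Free g) (Bound 1))"
    using x S(1) by (auto simp: close3_def)
  have "{f, g} \<inter> fv S = {}" using f S(1) fv_close3[of 0 x x' xR BR] by auto
  then have C': "close 4 f (close 3 g (close3 0 x x' xR ?C)) =
      App (App S (App (Bound 4) (Bound 2))) (App (Bound 3) (Bound 1))"
    unfolding C using x by (auto simp: close_fresh)
  \<comment> \<open>S mentions at most the three innermost indices, so skipping f and g leaves it
    unchanged.\<close>
  have "ren (\<lambda>x. x) (up_ren3 (\<lambda>k. k + 2)) S = ren (\<lambda>x. x) (\<lambda>k. k) S"
    using S(2)
  proof (rule ren_cong)
    show "up_ren3 (\<lambda>k. k + 2) k = k" if "k < 3" for k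
      using that by (cases k rule: triple_cases) auto
  qed simp
  then have S': "ren (\<lambda>x. x) (up_ren3 (\<lambda>k. k + 2)) S = S" by simp
  have xx: "x \<noteq> x'" using x(1) by simp
  show ?thesis
    unfolding prd3_named[OF assms(3) x(2) assms(4) x(3) xx] lam_def prd_rel_def S'
    using f assms(1-4) C' by (simp add: close_prd3 close_fresh ren_closed)
qed

lemma set_Var: "(x, x', xR) \<in> set \<Xi> \<Longrightarrow> {x, x', xR} \<subseteq> set (Var \<Xi>)"
  by (induction \<Xi>) auto

text \<open>\<open>p\<close> and \<open>r\<close> extend the lookup in \<Xi> to total functions,
  with arbitrary values at other names.\<close>

definition agree :: "pctx \<Rightarrow> (name \<Rightarrow> name) \<Rightarrow> (name \<Rightarrow> name) \<Rightarrow> bool" where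
  "agree \<Xi> p r \<longleftrightarrow> (\<forall>(x, x', xR) \<in> set \<Xi>. p x = x' \<and> r x = xR)"

lemma agree_Cons:
  assumes "agree \<Xi> p r" and "wf_pctx ((x, x', xR) # \<Xi>)"
  shows "agree ((x, x', xR) # \<Xi>) (p(x := x')) (r(x := xR))"
  using assms set_Var unfolding agree_def wf_pctx_def by fastforce

lemma agree_Var: "agree \<Xi> p r \<Longrightarrow> X \<subseteq> fst ` set \<Xi> \<Longrightarrow> X \<union> p ` X \<union> r ` X \<subseteq> set (Var \<Xi>)"
  unfolding agree_def using set_Var by fastforce

lemma ex_agree: "wf_pctx \<Xi> \<Longrightarrow> \<exists>p r. agree \<Xi> p r"
proof (induction \<Xi>)
  case Nil
  show ?case by (simp add: agree_def)
next
  case (Cons t \<Xi>)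
  obtain x x' xR where t: "t = (x, x', xR)" by (cases t)
  then have "wf_pctx \<Xi>" using Cons.prems by (simp add: wf_pctx_def)
  then obtain p r where "agree \<Xi> p r" using Cons.IH by blast
  then show ?case using agree_Cons Cons.prems t by blast
qed

text \<open>\<open>agree_Var\<close> puts the names of a related term and their images into
  \<open>Var \<Xi>\<close>, and a well-formed extension takes its triple from outside. All freshness
  conditions at one binder follow.\<close>

lemma param_binder:
  assumes wf: "wf_pctx ((x, x', xR) # \<Xi>)" and pr: "agree \<Xi> p r"
    and A: "fv A \<subseteq> fst ` set \<Xi>" and M: "fv M \<subseteq> fst ` set ((x, x', xR) # \<Xi>)"
  shows "distinct [x, x', xR]"
    and "{x, x', xR} \<inter> (fv A \<union> fv (ren p (\<lambda>k. k) A) \<union> fv (tr p r A)) = {}"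
    and "close 0 x' (ren (p(x := x')) (\<lambda>k. k) M) = ren p (\<lambda>k. k) (close 0 x M)"
    and "close3 0 x x' xR (tr (p(x := x')) (r(x := xR)) M) = tr p r (close 0 x M)"
proof -
  have d: "{x, x', xR} \<inter> set (Var \<Xi>) = {}" and d': "distinct [x, x', xR]"
    using wf by (auto simp: wf_pctx_def)
  show "distinct [x, x', xR]" by (fact d')
  have "fv A \<union> p ` fv A \<union> r ` fv A \<subseteq> set (Var \<Xi>)" by (rule agree_Var[OF pr A])
  then have "fv A \<union> fv (ren p (\<lambda>k. k) A) \<union> fv (tr p r A) \<subseteq> set (Var \<Xi>)"
    using fv_tr[of p r A] unfolding fv_ren by blast
  then show "{x, x', xR} \<inter> (fv A \<union> fv (ren p (\<lambda>k. k) A) \<union> fv (tr p r A)) = {}" using d by blast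
  have "fv M - {x} \<subseteq> fst ` set \<Xi>" using M by auto
  from agree_Var[OF pr this]
  have M': "fv M - {x} \<union> p ` (fv M - {x}) \<union> r ` (fv M - {x}) \<subseteq> set (Var \<Xi>)" .
  have "x' \<notin> p ` (fv M - {x})" using M' d by blast
  from close_ren_upd[OF this, of "\<lambda>k. k" 0]
  show "close 0 x' (ren (p(x := x')) (\<lambda>k. k) M) = ren p (\<lambda>k. k) (close 0 x M)" .
  have "x' \<notin> fv M" "xR \<notin> fv M" using M' d d' by auto
  moreover have "{x, x', xR} \<inter> (p ` (fv M - {x}) \<union> r ` (fv M - {x})) = {}" using M' d by blast
  ultimately show "close3 0 x x' xR (tr (p(x := x')) (r(x := xR)) M) = tr p r (close 0 x M)"
    using d' by (intro close3_tr) auto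
qed

lemma right_closed: "lc_at 0 M \<Longrightarrow> right p M = ren p (\<lambda>k. k) M"
  by (rule ren_cong) auto

text \<open>The functions p and r are generalised because a binder updates them at x. As M' and MR
  are determined by M, the judgement is deterministic up to the choice of bound names.\<close>

lemma param_tr:
  assumes "\<Xi> \<turnstile> M \<sim> M' because MR" and "agree \<Xi> p r"
  shows "lc_at 0 M \<and> fv M \<subseteq> fst ` set \<Xi> \<and> M' = ren p (\<lambda>k. k) M \<and> MR = tr p r M"
  using assms
proof (induction arbitrary: p r rule: param.induct)
  case (P_Sort a b \<Xi> i)
  then show ?case by (simp add: lam_def arrow_def)
next
  case (P_Var x x' xR \<Xi>)
  then show ?case by (force simp: agree_def)
next
  case (P_App \<Xi> M M' MR N N' NR)
  have "ren p (\<lambda>k. 3 * k + 1) N = ren p (\<lambda>k. k) N"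
    using P_App.IH(2)[OF P_App.prems] by (intro ren_cong[of 0]) auto
  then show ?case using P_App.IH[OF P_App.prems] by (simp add: ren_closed)
next
  case (P_Lam x x' xR \<Xi> A A' AR M M' MR)
  note A = P_Lam.IH(1)[OF P_Lam.prems]
    and M = P_Lam.IH(2)[OF agree_Cons[OF P_Lam.prems P_Lam.hyps(1)]]
  have "fv A \<subseteq> fst ` set \<Xi>" "fv M \<subseteq> fst ` set ((x, x', xR) # \<Xi>)" using A M by blast+
  note bnd = param_binder[OF P_Lam.hyps(1) P_Lam.prems this]
  have A': "A' = ren p (\<lambda>k. k) A" "AR = tr p r A" "lc_at 0 A" "lc_at 0 A'" "lc_at 0 AR"
    using A lc_at_ren[of 0 A "\<lambda>k. k" 0 p] lc_at_tr[of 0 A p r] by auto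
  have MR: "close3 0 x x' xR MR = tr p r (close 0 x M)"
    using bnd(4) M by (simp del: fun_upd_apply)
  have e: "left A = A" "right p A = A'"
    using A' by (simp_all only: ren_closed right_closed)
  have "lam x A (lam x' A' (lam xR (AR \<bullet> Free x \<bullet> Free x') MR)) = tr p r (lam x A M)"
    unfolding lam_def[of x A M] tr.simps e A'(2)[symmetric] MR[symmetric]
    using bnd(1,2) A' by (intro lam3_named) auto
  moreover have "lam x' A' M' = ren p (\<lambda>k. k) (lam x A M)"
    using bnd(3) A' M by (simp add: lam_def up_ren_id[abs_def] del: fun_upd_apply)
  moreover have "fv (lam x A M) \<subseteq> fst ` set \<Xi>"
    using A M by (auto simp: lam_def fv_close)
  ultimately show ?case using A M by (simp add: lc_at_close)
next
  case (P_Pi x x' xR \<Xi> A A' AR B B' BR f g)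
  note A = P_Pi.IH(1)[OF P_Pi.prems]
    and B = P_Pi.IH(2)[OF agree_Cons[OF P_Pi.prems P_Pi.hyps(1)]]
  have "fv A \<subseteq> fst ` set \<Xi>" "fv B \<subseteq> fst ` set ((x, x', xR) # \<Xi>)" using A B by blast+
  note bnd = param_binder[OF P_Pi.hyps(1) P_Pi.prems this]
  have A': "A' = ren p (\<lambda>k. k) A" "AR = tr p r A" "lc_at 0 A" "lc_at 0 A'" "lc_at 0 AR"
    using A lc_at_ren[of 0 A "\<lambda>k. k" 0 p] lc_at_tr[of 0 A p r] by auto
  have P: "lc_at 0 (prd x A B)" using A B by (simp add: lc_at_close)
  have P': "prd x' A' B' = ren p (\<lambda>k. k) (prd x A B)"
    using bnd(3) A' B by (simp add: prd_def up_ren_id[abs_def] del: fun_upd_apply)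
  then have lcP': "lc_at 0 (prd x' A' B')" using lc_at_ren[OF P, of "\<lambda>k. k" 0 p] by simp
  have "lc_at 3 (tr p r (close 0 x B))"
    using lc_at_tr[OF lc_at_close[of 0 B x]] B by simp
  moreover have "close3 0 x x' xR BR = tr p r (close 0 x B)" using bnd(4) B by (simp del: fun_upd_apply)
  moreover have "fv (prd x' A' B') \<subseteq> fv A' \<union> fv B'" by (auto simp: prd_def fv_close)
  ultimately have "lam f (prd x A B) (lam g (prd x' A' B')
        (prd x A (prd x' A' (prd xR (AR \<bullet> Free x \<bullet> Free x')
          (BR \<bullet> (Free f \<bullet> Free x) \<bullet> (Free g \<bullet> Free x')))))) =
      prd_rel (prd x A B) (prd x' A' B') A A' AR (tr p r (close 0 x B))"
    using P_Pi.hyps(4,5) A' bnd(2) lcP' by (intro prd_rel_named) auto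
  also have "\<dots> = tr p r (prd x A B)"
  proof -
    have e: "left A = A" "right p A = A'" "left (prd x A B) = prd x A B"
        "right p (prd x A B) = prd x' A' B'"
      using P P' A' by (simp_all only: ren_closed right_closed)
    from tr.simps(6)[of p r A "close 0 x B", folded prd_def] show ?thesis
      by (simp only: e A'(2))
  qed
  finally show ?case using P P' A B by (auto simp: prd_def fv_close)
qed

theorem theorem4:
  fixes \<Gamma> :: ctx and \<Xi> :: pctx and M A M' MR A' AR :: trm
  assumes "\<Gamma> \<rhd> \<Xi>"
    and "types_related \<Gamma> \<Xi>"
    and "\<Gamma> \<turnstile> M \<^bold>: A"
    and "\<Xi> \<turnstile> M \<sim> M' because MR"
    and "\<Xi> \<turnstile> A \<sim> A' because AR"
  shows "\<Gamma> \<turnstile> M' \<^bold>: A' \<and> \<Gamma> \<turnstile> MR \<^bold>: AR \<bullet> M \<bullet> M'"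
proof -
  have wf: "wf_ctx \<Gamma>" and "wf_pctx \<Xi>" using assms(1) by (simp_all add: admissible_def)
  then obtain p r where pr: "agree \<Xi> p r" using ex_agree by blast
  note M = param_tr[OF assms(4) pr] and A = param_tr[OF assms(5) pr]
  let ?D = "fst ` set \<Xi>"
  let ?G = "map_of \<Gamma> |` ?D"
  have dep: "\<exists>C' CR. \<Xi> \<turnstile> C \<sim> C' because CR" if "map_of \<Gamma> x = Some C" "x \<in> ?D" for x C
    using assms(2) that unfolding types_related_def by force
  have typed: "typed_ctx \<Gamma>" and "has (map_of \<Gamma>) [] M A"
    using typing_has(1)[OF wf] typing_has(2)[OF assms(3)] by simp_all
  \<comment> \<open>The last subgoal asks that the domain of \<Xi> be closed under types: by
    \<open>dep\<close> such a type is related, and \<open>param_tr\<close> bounds its names.\<close>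
  then have MA: "has ?G [] M A"
    using M A dep param_tr[OF _ pr] by (intro has_restrict) (simp, simp, simp, simp, blast)
  \<comment> \<open>Only the source context is restricted: the partners p x and r x lie outside the
    domain of \<Xi>, so the results are typed in the full context.\<close>
  have ok: "param_ok p r ?G (map_of \<Gamma>)"
    unfolding param_ok_def
  proof (intro allI impI)
    fix x C assume "?G x = Some C" and lc: "lc_at 0 C"
    then have x: "map_of \<Gamma> x = Some C" "x \<in> ?D" by (auto simp: restrict_map_def split: if_splits)
    then have "(x, p x, r x) \<in> set \<Xi>" using pr unfolding agree_def by auto
    moreover obtain C' CR where C: "\<Xi> \<turnstile> C \<sim> C' because CR" using dep x by blast
    ultimately obtain T where T: "map_of \<Gamma> (p x) = Some C'" "map_of \<Gamma> (r x) = Some T"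
        "T \<equiv>\<^sub>\<beta> CR \<bullet> Free x \<bullet> Free (p x)"
      using assms(1) x(1) unfolding admissible_def by meson
    moreover have "C' = ren p (\<lambda>k. k) C" "CR = tr p r C" using param_tr[OF C pr] by simp_all
    moreover obtain i where "has (map_of \<Gamma>) [] T (Sort i)"
      using T(2) typed unfolding typed_ctx_def by blast
    ultimately show "map_of \<Gamma> x = Some C \<and> map_of \<Gamma> (p x) = Some (ren p (\<lambda>k. k) C) \<and>
        (\<exists>T i. map_of \<Gamma> (r x) = Some T \<and> lc_at 0 T \<and> has (map_of \<Gamma>) [] T (Sort i) \<and>
          T \<approx> App (App (tr p r C) (Free x)) (Free (p x)))"
      using x(1) conv_cv typed_ctxD(1)[OF typed T(2)] by blast
  qed
  have typing: "\<Gamma> \<turnstile> N \<^bold>: C" if "has (map_of \<Gamma>) [] N C" for N C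
  proof -
    have "lc_at 0 N" "lc_at 0 C" using that has_type has_fv by fastforce+
    \<comment> \<open>There are no local variables and both terms are closed, so opening with the
      dummy name 0 changes nothing.\<close>
    then show ?thesis
      using has_typing[OF that wf, of "\<lambda>_. 0"] by (simp add: opn_closed)
  qed
  have "right p M = M'" "right p A = A'"
    using M A by (auto intro: ren_cong[of 0])
  then show ?thesis
    using typing[OF has_right[OF ok MA, unfolded ctx_rel.simps]]
      typing[OF has_tr[OF MA ok, unfolded ctx_rel.simps]] M A
    by (simp add: ren_closed)
qed

end
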